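(* Let $p>1$, $p\ne 2$. Let $n\ge2$, let $m$ be a positive integer and $m_1\le m_2$ positive integers with $n=\tfrac12(m_1+m_2)m+2$, and let $\phi$ be a homogeneous polynomial on $\mathbb{R}^n$ of degree $m$ satisfying $|\nabla\phi(x)|^2=m^2|x|^{2m-2}$ and $\Delta\phi(x)=\tfrac12(m_2-m_1)m^2|x|^{m-2}$. Then there is no homogeneous polynomial $u$ on $\mathbb{R}^n$ with $\deg u\ge 2$ which satisfies $\Delta_p u=0$ and has the form $u(x)=f(|x|^m,\phi(x))$ for some $C^2$ function $f(s,t)$.
   Context: The $p$-Laplacian of a $C^2$ function $u$ is $\Delta_p u:=|\nabla u|^2\Delta u+\tfrac{p-2}{2}\nabla u\cdot\nabla|\nabla u|^2$. *)

theory Defs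
  imports "HOL-Analysis.Analysis"
begin

definition hom_poly :: "nat \<Rightarrow> (real^'n::finite \<Rightarrow> real) \<Rightarrow> bool" where
  "hom_poly d u \<longleftrightarrow>
     (\<exists>c :: ('n \<Rightarrow> nat) \<Rightarrow> real. \<forall>x.
        u x = (\<Sum>\<alpha>\<in>{\<alpha>. sum \<alpha> UNIV = d}. c \<alpha> * (\<Prod>i\<in>UNIV. (x $ i) ^ \<alpha> i)))"

definition partial :: "(real^'n::finite \<Rightarrow> real) \<Rightarrow> 'n \<Rightarrow> real^'n \<Rightarrow> real" where
  "partial u i x = deriv (\<lambda>t. u (x + t *\<^sub>R axis i 1)) 0"

definition grad :: "(real^'n::finite \<Rightarrow> real) \<Rightarrow> real^'n \<Rightarrow> real^'n" where
  "grad u x = (\<chi> i. partial u i x)"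

definition laplacian :: "(real^'n::finite \<Rightarrow> real) \<Rightarrow> real^'n \<Rightarrow> real" where
  "laplacian u x = (\<Sum>i\<in>UNIV. partial (\<lambda>y. partial u i y) i x)"

definition p_laplacian :: "real \<Rightarrow> (real^'n::finite \<Rightarrow> real) \<Rightarrow> real^'n \<Rightarrow> real" where
  "p_laplacian p u x =
     (norm (grad u x))\<^sup>2 * laplacian u x
     + (p - 2) / 2 * (grad u x \<bullet> grad (\<lambda>y. (norm (grad u y))\<^sup>2) x)"

definition C2_on :: "(real \<times> real) set \<Rightarrow> (real \<times> real \<Rightarrow> real) \<Rightarrow> bool" where
  "C2_on U f \<longleftrightarrow> open U \<and>
     (\<exists>(Df :: real \<times> real \<Rightarrow> (real \<times> real) \<Rightarrow>\<^sub>L real)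
        (D2f :: real \<times> real \<Rightarrow> (real \<times> real) \<Rightarrow>\<^sub>L ((real \<times> real) \<Rightarrow>\<^sub>L real)).
        (\<forall>z\<in>U. (f has_derivative blinfun_apply (Df z)) (at z)) \<and>
        (\<forall>z\<in>U. (Df has_derivative blinfun_apply (D2f z)) (at z)) \<and>
        continuous_on U D2f)"

end

theory Submission
  imports Defs "HOL-Computational_Algebra.Fundamental_Theorem_Algebra"
begin

text \<open>On the unit sphere \<open>u = g(\<phi>)\<close>. Along a suitable great circle, namely one tangent to \<open>\<nabla>\<phi>\<close>,
  the eikonal equation forces \<open>\<phi> = cos (m\<theta>)\<close>. There \<open>u\<close> is a trigonometric polynomial in \<open>\<theta>\<close> which is a
  function of \<open>cos (m\<theta>)\<close>, hence \<open>g\<close> is a polynomial and \<open>\<Delta>\<^sub>p u = 0\<close> becomes a polynomial identity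
  \<open>w L + (p - 2)/2 (2d(d - 1) g w + m\<^sup>2(1 - t\<^sup>2) g' w') = 0\<close> over the complex numbers, where
  \<open>w = d\<^sup>2g\<^sup>2 + m\<^sup>2(1 - t\<^sup>2)g'\<^sup>2\<close> represents \<open>|\<nabla>u|\<^sup>2\<close> and \<open>L\<close> represents \<open>\<Delta>u\<close>. Comparing lowest order terms at a
  complex root of \<open>w\<close> shows that there is none: if \<open>g\<close> vanishes there to order \<open>l\<close>, it would give
  \<open>(p - 1)(2l - 1) + m\<^sub>i = 0\<close> at \<open>t = \<plusminus>1\<close>, and \<open>p = 1\<close> or \<open>p = 2\<close> elsewhere. So \<open>w\<close> is constant, and the leading coefficients of the identity and of \<open>w\<close> give
  either \<open>d(d + n - 2) + (p - 2)d(d - 1) = 0\<close> or \<open>d = m deg g\<close> and \<open>(p - 2)d(d - 1) = 0\<close>.\<close>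

subsection \<open>The polynomial differential equation\<close>

text \<open>The operator \<open>y d/dy\<close> preserves the factor \<open>y ^ l\<close>, also for
  \<open>l = 0\<close>.\<close>

lemma mult_pderiv_power_mult:
  fixes y Q :: "'a::idom poly"
  assumes "pderiv y = 1"
  shows "y * pderiv (y ^ l * Q) = y ^ l * (of_nat l * Q + y * pderiv Q)"
proof (cases l)
  case (Suc k)
  show ?thesis
    unfolding Suc pderiv_mult pderiv_power_Suc
    by (simp add: assms algebra_simps of_nat_poly smult_add_left)
qed simp

text \<open>An index below \<open>m\<close> in one factor forces one above \<open>n\<close> in the
  other. Degree bounds instead of equalities admit factors with vanishing top coefficient, such as
  \<open>pderiv g\<close> with bound \<open>degree g\<close>.\<close>

lemma coeff_mult_degree_le:
  fixes p q :: "'a::comm_semiring_0 poly"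
  assumes "degree p \<le> m" "degree q \<le> n"
  shows "coeff (p * q) (m + n) = coeff p m * coeff q n"
proof -
  have "coeff p i * coeff q (m + n - i) = 0" if "i \<noteq> m" for i
  proof (cases "i < m")
    case True
    then have "degree q < m + n - i" using assms by linarith
    then show ?thesis by (simp add: coeff_eq_0)
  next
    case False
    then have "degree p < i" using assms that by linarith
    then show ?thesis by (simp add: coeff_eq_0)
  qed
  then have "(\<Sum>i\<le>m+n. coeff p i * coeff q (m + n - i)) =
      (\<Sum>i\<in>{m}. coeff p i * coeff q (m + n - i))"
    by (intro sum.mono_neutral_right) auto
  then show ?thesis by (simp add: coeff_mult)
qed

text \<open>For \<open>u = |x|\<^sup>d G(\<phi> / |x|\<^sup>m)\<close> the following polynomials in \<open>t = \<phi> / |x|\<^sup>m\<close> are the values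
  on the unit sphere of \<open>|\<nabla>u|\<^sup>2\<close>, \<open>\<Delta>u\<close> and \<open>\<Delta>\<^sub>p u\<close>, where \<open>r = (p - 2) / 2\<close>,
  \<open>a = (m\<^sub>1 + m\<^sub>2) / 2\<close>, \<open>b = (m\<^sub>2 - m\<^sub>1) / 2\<close> and \<open>n\<close> is the dimension.\<close>

definition ode_weight :: "'a::idom \<Rightarrow> 'a \<Rightarrow> 'a poly \<Rightarrow> 'a poly" where
  "ode_weight d m G = [:d^2:] * G^2 + [:m^2:] * (1 - [:0,1:]^2) * (pderiv G)^2"

definition ode_laplacian :: "'a::idom \<Rightarrow> 'a \<Rightarrow> 'a \<Rightarrow> 'a \<Rightarrow> 'a \<Rightarrow> 'a poly \<Rightarrow> 'a poly" where
  "ode_laplacian d m n a b G =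
     [:m^2:] * (1 - [:0,1:]^2) * pderiv (pderiv G)
     - [:m^2:] * [:- b, 1 + a:] * pderiv G + [:d * (d + n - 2):] * G"

definition ode_p_laplacian ::
    "'a::idom \<Rightarrow> 'a \<Rightarrow> 'a \<Rightarrow> 'a \<Rightarrow> 'a \<Rightarrow> 'a \<Rightarrow> 'a poly \<Rightarrow> 'a poly" where
  "ode_p_laplacian r d m n a b G =
     ode_weight d m G * ode_laplacian d m n a b G
     + [:r:] * ([:d * (2 * d - 2):] * G * ode_weight d m G
                + [:m^2:] * (1 - [:0,1:]^2) * pderiv G * pderiv (ode_weight d m G))"

text \<open>With \<open>y = t - \<tau>\<close> this is the equation divided by its power of \<open>y\<close>; derivatives enter as
  \<open>y G'\<close> and \<open>y\<^sup>2 G''\<close> so that no truncated exponent \<open>l - 1\<close> or \<open>l - 2\<close> occurs.\<close>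

lemma ode_root_expansion:
  fixes G :: "'a::idom poly"
  assumes y: "pderiv y = 1" and y0: "y \<noteq> 0" and G: "G = y ^ l * Q"
    and ode: "ode_p_laplacian r d m n a b G = 0"
  defines "q \<equiv> 1 - [:0,1:]^2"
  defines "Q1 \<equiv> of_nat l * Q + y * pderiv Q"
  defines "Q2 \<equiv> (of_nat l - 1) * Q1 + y * pderiv Q1"
  defines "V \<equiv> [:d^2:] * y^2 * Q^2 + [:m^2:] * q * Q1^2"
  shows "y^2 * ode_weight d m G = y^(2*l) * V"
    and "V * ([:m^2:] * q * Q2 - [:m^2:] * [:- b, 1 + a:] * y * Q1 + [:d * (d + n - 2):] * y^2 * Q)
       + [:r:] * ([:d * (2 * d - 2):] * y^2 * Q * V
                + [:m^2:] * q * Q1 * ((2 * of_nat l - 2) * V + y * pderiv V)) = 0" (is "?T = 0")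
proof -
  define w where "w = ode_weight d m G"
  have G1: "y * pderiv G = y^l * Q1"
    using mult_pderiv_power_mult[OF y, of l Q] by (simp add: G Q1_def)
  have "y * pderiv (y * pderiv G) = y^l * (of_nat l * Q1 + y * pderiv Q1)"
    unfolding G1 by (rule mult_pderiv_power_mult[OF y])
  moreover have "y * pderiv (y * pderiv G) = y^2 * pderiv (pderiv G) + y * pderiv G"
    by (simp add: pderiv_mult y algebra_simps power2_eq_square)
  ultimately have G2: "y^2 * pderiv (pderiv G) = y^l * Q2"
    unfolding G1 Q2_def by (simp add: algebra_simps)
  have "y^2 * w = [:d^2:] * y^2 * G^2 + [:m^2:] * q * (y * pderiv G)^2"
    unfolding w_def ode_weight_def q_def by (simp only: algebra_simps power_mult_distrib)
  also have "\<dots> = y^(2*l) * V"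
    unfolding G1 unfolding G V_def
    by (simp only: power_mult_distrib power_mult[symmetric] mult.commute[of 2] algebra_simps)
  finally show W: "y^2 * ode_weight d m G = y^(2*l) * V" unfolding w_def .
  then have "y * pderiv (y^2 * w) = y^(2*l) * (of_nat (2*l) * V + y * pderiv V)"
    unfolding w_def by (simp only: mult_pderiv_power_mult[OF y])
  moreover have "y * pderiv (y^2 * w) = y^3 * pderiv w + 2 * (y^2 * w)"
    by (simp add: pderiv_mult power2_eq_square power3_eq_cube y algebra_simps)
  ultimately have W1: "y^3 * pderiv w = y^(2*l) * ((2 * of_nat l - 2) * V + y * pderiv V)"
    using W unfolding w_def by (simp add: algebra_simps)
  \<comment> \<open>Every term is cubic in \<open>G\<close> and its derivatives, with at most four
    differentiations in total. So \<open>y^4\<close> compensates all of them and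
    \<open>y^(3*l)\<close> splits off.\<close>
  have "0 = y^4 * ode_p_laplacian r d m n a b G" using ode by simp
  also have "\<dots> = (y^2 * w) * ([:m^2:] * q * (y^2 * pderiv (pderiv G))
      - [:m^2:] * [:- b, 1 + a:] * y * (y * pderiv G) + [:d * (d + n - 2):] * y^2 * G)
     + [:r:] * ([:d * (2 * d - 2):] * y^2 * G * (y^2 * w)
                + [:m^2:] * q * (y * pderiv G) * (y^3 * pderiv w))"
    unfolding ode_p_laplacian_def ode_laplacian_def w_def[symmetric] q_def[symmetric]
    by algebra
  also have "\<dots> = y^l * y^(2*l) * ?T"
    unfolding G1 G2 W[folded w_def] W1 unfolding G by algebra
  finally show "?T = 0" using y0 by simp
qed

text \<open>At \<open>t^2 = 1\<close> the weight is \<open>d^2 * G^2\<close>, so a root is a zero of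
  \<open>G\<close> of order \<open>l > 0\<close>. As \<open>1 - t^2\<close> has a simple zero there,
  the lowest order term is a nonzero multiple of \<open>(2 * r + 1) * (2 * l - 1) + (a - b)\<close>
  or the same with \<open>a + b\<close>, both positive.\<close>

lemma ode_weight_no_root_endpoint:
  fixes G :: "complex poly" and r a b n :: real
  assumes ode: "ode_p_laplacian (of_real r) (of_nat d) (of_nat m) (of_real n) (of_real a) (of_real b) G = 0"
    and G: "G \<noteq> 0" and d: "d > 0" and m: "m > 0" and r: "2 * r + 1 > 0" and ab: "\<bar>b\<bar> < a" and unit: "\<tau>^2 = 1"
  shows "poly (ode_weight (of_nat d) (of_nat m) G) \<tau> \<noteq> 0"
proof
  define w where "w = ode_weight (of_nat d) (of_nat m) G"
  define y where "y = [:- \<tau>, 1:]"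
  define l where "l = order \<tau> G"
  assume "poly (ode_weight (of_nat d) (of_nat m) G) \<tau> = 0"
  then have w0: "poly w \<tau> = 0" by (simp add: w_def)
  have y: "pderiv y = 1" "y \<noteq> 0" "poly y \<tau> = 0"
    by (simp_all add: y_def pderiv_pCons)
  obtain Q where Q: "G = y ^ l * Q" "\<not> y dvd Q"
    using order_decomp[OF G, of \<tau>] unfolding l_def y_def by blast
  have Q0: "poly Q \<tau> \<noteq> 0" using Q(2) by (simp add: y_def poly_eq_0_iff_dvd)
  define q :: "complex poly" where "q = 1 - [:0,1:]^2"
  define Q1 where "Q1 = of_nat l * Q + y * pderiv Q"
  define Q2 where "Q2 = (of_nat l - 1) * Q1 + y * pderiv Q1"
  define D :: complex where "D = of_nat d"
  define M :: complex where "M = of_nat m"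
  define V where "V = [:D^2:] * y^2 * Q^2 + [:M^2:] * q * Q1^2"
  define \<beta> :: "complex poly" where "\<beta> = [:- of_real b, 1 + of_real a:]"
  define c1 where "c1 = D * (D + of_real n - 2)"
  define c2 where "c2 = D * (2 * D - 2)"
  have DM: "D \<noteq> 0" "M \<noteq> 0" using d m by (auto simp: D_def M_def)
  note exp = ode_root_expansion[OF y(1,2) Q(1) ode, folded q_def D_def M_def, folded Q1_def \<beta>_def c1_def c2_def,
      folded Q2_def V_def]
  have W: "y^2 * w = y^(2*l) * V" using exp(1) by (simp add: w_def D_def M_def)
  have T: "V * ([:M^2:] * q * Q2 - [:M^2:] * \<beta> * y * Q1 + [:c1:] * y^2 * Q)
     + [:of_real r:] * ([:c2:] * y^2 * Q * V
                + [:M^2:] * q * Q1 * ((2 * of_nat l - 2) * V + y * pderiv V)) = 0"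
    by (rule exp(2))
  have Q10: "poly Q1 \<tau> = of_nat l * poly Q \<tau>" by (simp add: Q1_def y)
  have Q20: "poly Q2 \<tau> = (of_nat l - 1) * of_nat l * poly Q \<tau>" by (simp add: Q2_def y Q10)
  \<comment> \<open>Here \<open>q'\<close> and, below, \<open>V'\<close> are the quotients of
    \<open>q\<close> and \<open>V\<close> by \<open>y\<close>, not derivatives.\<close>
  define q' where "q' = - [:\<tau>, 1:]"
  have qq: "q = y * q'" using unit unfolding q_def q'_def y_def
    by (simp add: power2_eq_square one_pCons)
  have q'0: "poly q' \<tau> = - 2 * \<tau>" by (simp add: q'_def)
  have \<tau>0: "\<tau> \<noteq> 0" using unit by auto
  have G0: "poly G \<tau> = 0"
  proof -
    have "poly w \<tau> = D^2 * (poly G \<tau>)^2"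
      using unit by (simp add: w_def ode_weight_def D_def M_def)
    then show ?thesis using w0 DM by simp
  qed
  have l: "l > 0" using G0 Q Q0 by (cases l) auto
  define V' where "V' = [:D^2:] * y * Q^2 + [:M^2:] * q' * Q1^2"
  have VV: "V = y * V'" unfolding V_def V'_def qq by algebra
  have V1: "pderiv V = V' + y * pderiv V'" unfolding VV by (simp add: pderiv_mult y)
  have V'0: "poly V' \<tau> \<noteq> 0" using DM \<tau>0 Q0 l by (simp add: V'_def y Q10 q'0)
  have "0 = V * ([:M^2:] * q * Q2 - [:M^2:] * \<beta> * y * Q1 + [:c1:] * y^2 * Q)
   + [:of_real r:] * ([:c2:] * y^2 * Q * V
              + [:M^2:] * q * Q1 * ((2 * of_nat l - 2) * V + y * pderiv V))"
    by (simp only: T)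
  \<comment> \<open>One more factor \<open>y\<close> in \<open>V\<close> raises the exponent
    \<open>2 * l - 2\<close> to \<open>2 * l - 1\<close>.\<close>
  also have "\<dots> = y^2 * (V' * ([:M^2:] * q' * Q2 - [:M^2:] * \<beta> * Q1 + [:c1:] * y * Q)
   + [:of_real r:] * ([:c2:] * y * Q * V'
              + [:M^2:] * q' * Q1 * ((2 * of_nat l - 1) * V' + y * pderiv V')))"
    unfolding V1 unfolding VV qq by algebra
  finally have "V' * ([:M^2:] * q' * Q2 - [:M^2:] * \<beta> * Q1 + [:c1:] * y * Q)
   + [:of_real r:] * ([:c2:] * y * Q * V'
              + [:M^2:] * q' * Q1 * ((2 * of_nat l - 1) * V' + y * pderiv V')) = 0" (is "?S = 0")
    using y(2) by simp
  then have "0 = poly ?S \<tau>" by simp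
  also have "\<dots> = poly V' \<tau> * M^2 * of_nat l * poly Q \<tau> *
      (- 2 * \<tau> * (of_nat l - 1) - ((1 + of_real a) * \<tau> - of_real b) - 2 * of_real r * \<tau> * (2 * of_nat l - 1))"
    by (simp add: y Q10 Q20 q'0 \<beta>_def) (simp add: algebra_simps)
  finally have "- 2 * \<tau> * (of_nat l - 1) - ((1 + of_real a) * \<tau> - of_real b) - 2 * of_real r * \<tau> * (2 * of_nat l - 1) = 0"
    using V'0 DM l Q0 by simp
  moreover from unit have "\<tau> = 1 \<or> \<tau> = -1" by (simp add: power2_eq_1_iff)
  ultimately have "of_real ((2 * r + 1) * (2 * real l - 1) + (a - b)) = (0::complex)
    \<or> of_real ((2 * r + 1) * (2 * real l - 1) + (a + b)) = (0::complex)"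
    by (auto simp: algebra_simps)
  then have "(2 * r + 1) * (2 * real l - 1) + (a - b) = 0 \<or> (2 * r + 1) * (2 * real l - 1) + (a + b) = 0"
    by (simp only: of_real_eq_0_iff)
  moreover have "(2 * r + 1) * (2 * real l - 1) > 0" using r l by simp
  ultimately show False using ab by auto
qed

text \<open>Away from the endpoints \<open>q\<close> is nonzero at the root. Order
  \<open>l \<ge> 2\<close> of \<open>G\<close> contradicts \<open>2 * r + 1 > 0\<close>, order 1
  makes the weight nonzero, and order 0 forces \<open>r = 0\<close>.\<close>

lemma ode_weight_no_root:
  fixes G :: "complex poly" and r a b n :: real
  assumes ode: "ode_p_laplacian (of_real r) (of_nat d) (of_nat m) (of_real n) (of_real a) (of_real b) G = 0"
    and G: "G \<noteq> 0" and d: "d > 0" and m: "m > 0" and r: "2 * r + 1 > 0" "r \<noteq> 0" and ab: "\<bar>b\<bar> < a"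
  shows "poly (ode_weight (of_nat d) (of_nat m) G) \<tau> \<noteq> 0"
proof
  define w where "w = ode_weight (of_nat d) (of_nat m) G"
  define y where "y = [:- \<tau>, 1:]"
  define l where "l = order \<tau> G"
  assume "poly (ode_weight (of_nat d) (of_nat m) G) \<tau> = 0"
  then have w0: "poly w \<tau> = 0" by (simp add: w_def)
  have y: "pderiv y = 1" "y \<noteq> 0" "poly y \<tau> = 0"
    by (simp_all add: y_def pderiv_pCons)
  obtain Q where Q: "G = y ^ l * Q" "\<not> y dvd Q"
    using order_decomp[OF G, of \<tau>] unfolding l_def y_def by blast
  have Q0: "poly Q \<tau> \<noteq> 0" using Q(2) by (simp add: y_def poly_eq_0_iff_dvd)
  define q :: "complex poly" where "q = 1 - [:0,1:]^2"
  define Q1 where "Q1 = of_nat l * Q + y * pderiv Q"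
  define Q2 where "Q2 = (of_nat l - 1) * Q1 + y * pderiv Q1"
  define D :: complex where "D = of_nat d"
  define M :: complex where "M = of_nat m"
  define V where "V = [:D^2:] * y^2 * Q^2 + [:M^2:] * q * Q1^2"
  define \<beta> :: "complex poly" where "\<beta> = [:- of_real b, 1 + of_real a:]"
  define c1 where "c1 = D * (D + of_real n - 2)"
  define c2 where "c2 = D * (2 * D - 2)"
  have DM: "D \<noteq> 0" "M \<noteq> 0" using d m by (auto simp: D_def M_def)
  note exp = ode_root_expansion[OF y(1,2) Q(1) ode, folded q_def D_def M_def, folded Q1_def \<beta>_def c1_def c2_def,
      folded Q2_def V_def]
  have W: "y^2 * w = y^(2*l) * V" using exp(1) by (simp add: w_def D_def M_def)
  have T: "V * ([:M^2:] * q * Q2 - [:M^2:] * \<beta> * y * Q1 + [:c1:] * y^2 * Q)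
     + [:of_real r:] * ([:c2:] * y^2 * Q * V
                + [:M^2:] * q * Q1 * ((2 * of_nat l - 2) * V + y * pderiv V)) = 0"
    by (rule exp(2))
  have Q10: "poly Q1 \<tau> = of_nat l * poly Q \<tau>" by (simp add: Q1_def y)
  have Q20: "poly Q2 \<tau> = (of_nat l - 1) * of_nat l * poly Q \<tau>" by (simp add: Q2_def y Q10)
  have non_unit: "\<tau>^2 \<noteq> 1"
    using ode_weight_no_root_endpoint[OF ode G d m r(1) ab, of \<tau>] w0 by (auto simp: w_def)
  then have q0: "poly q \<tau> \<noteq> 0" by (simp add: q_def)
  have V0: "poly V \<tau> = M^2 * poly q \<tau> * (of_nat l * poly Q \<tau>)^2" by (simp add: V_def y Q10)
  have "0 = poly (V * ([:M^2:] * q * Q2 - [:M^2:] * \<beta> * y * Q1 + [:c1:] * y^2 * Q)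
   + [:of_real r:] * ([:c2:] * y^2 * Q * V
              + [:M^2:] * q * Q1 * ((2 * of_nat l - 2) * V + y * pderiv V))) \<tau>"
    by (simp only: T poly_0)
  also have "\<dots> = poly V \<tau> * M^2 * poly q \<tau> * of_nat l * poly Q \<tau> * (of_nat l - 1) * of_real (2 * r + 1)"
    by (simp add: y Q10 Q20) (simp add: algebra_simps)
  \<comment> \<open>The factor \<open>l * (l - 1)\<close> comes from the second derivative and from
    \<open>2 * l - 2\<close>; for \<open>l > 0\<close> the value of \<open>V\<close> is nonzero, so
    only \<open>l = 0\<close> and \<open>l = 1\<close> survive.\<close>
  finally have "poly V \<tau> = 0 \<or> l = 0 \<or> l = 1"
    using DM q0 Q0 r(1) by (auto simp del: of_real_add of_real_mult)
  then consider "l = 0" | "l = 1" using DM q0 Q0 unfolding V0 by auto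
  then show False
  proof cases
    case 2
    then have "w = V" using W y(2) by simp
    then show False using w0 V0 2 DM q0 Q0 by simp
  next
    case 1
    then have GQ: "G = Q" using Q by simp
    have wG: "w = [:D^2:] * G^2 + [:M^2:] * q * (pderiv G)^2"
      by (simp add: w_def ode_weight_def q_def D_def M_def)
    have G1: "poly (pderiv G) \<tau> \<noteq> 0"
      using w0 Q0 DM unfolding wG GQ by auto
    \<comment> \<open>The endpoint 1 is not a root, so \<open>w\<close> has a finite order at
      \<tau>.\<close>
    have "w \<noteq> 0"
      using ode_weight_no_root_endpoint[OF ode G d m r(1) ab, of 1] by (auto simp: w_def)
    define j where "j = order \<tau> w"
    obtain U where U: "w = y ^ j * U" "\<not> y dvd U"
      using order_decomp[OF \<open>w \<noteq> 0\<close>, of \<tau>] unfolding j_def y_def by blast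
    have U0: "poly U \<tau> \<noteq> 0" using U(2) by (simp add: y_def poly_eq_0_iff_dvd)
    have j: "j > 0" using w0 U U0 by (cases j) auto
    have w1: "y * pderiv w = y^j * (of_nat j * U + y * pderiv U)"
      unfolding U(1) by (rule mult_pderiv_power_mult[OF y(1)])
    define L where "L = ode_laplacian D M (of_real n) (of_real a) (of_real b) G"
    \<comment> \<open>Only the term with \<open>pderiv w\<close> has order \<open>j - 1\<close>; its
      leading factor is \<open>r * M^2 * q * pderiv G * j * U\<close>, and all other terms have
      order at least \<open>j\<close>.\<close>
    have "0 = y * ode_p_laplacian (of_real r) D M (of_real n) (of_real a) (of_real b) G"
      using ode by (simp add: D_def M_def)
    also have "\<dots> = y * w * L + [:of_real r:] * ([:c2:] * G * y * w + [:M^2:] * q * pderiv G * (y * pderiv w))"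
      unfolding ode_p_laplacian_def L_def w_def D_def[symmetric] M_def[symmetric] q_def[symmetric] c2_def[symmetric]
      by algebra
    also have "\<dots> = y^j * (y * U * L + [:of_real r:] * ([:c2:] * G * y * U + [:M^2:] * q * pderiv G * (of_nat j * U + y * pderiv U)))"
      unfolding w1 unfolding U(1) by algebra
    finally have "poly (y * U * L + [:of_real r:] * ([:c2:] * G * y * U + [:M^2:] * q * pderiv G * (of_nat j * U + y * pderiv U))) \<tau> = 0"
      using y(2) by simp
    then show False using y(3) r(2) DM q0 G1 j U0 by simp
  qed
qed

section \<open>Passage to complex coefficients and comparison of leading coefficients\<close>

lemma map_poly_of_real_hom:
  fixes p q :: "real poly"
  shows "map_poly complex_of_real (p + q) = map_poly of_real p + map_poly of_real q"
    and "map_poly complex_of_real (p - q) = map_poly of_real p - map_poly of_real q"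
    and "map_poly complex_of_real (p * q) = map_poly of_real p * map_poly of_real q"
    and "map_poly complex_of_real (pderiv p) = pderiv (map_poly of_real p)"
    and "map_poly complex_of_real 1 = 1"
  by (auto simp: poly_eq_iff coeff_map_poly coeff_mult coeff_pderiv)

lemma map_poly_ode_p_laplacian:
  fixes g :: "real poly"
  shows "map_poly complex_of_real (ode_p_laplacian r d m n a b g) =
    ode_p_laplacian (of_real r) (of_real d) (of_real m) (of_real n) (of_real a) (of_real b)
      (map_poly of_real g)"
  unfolding ode_p_laplacian_def ode_weight_def ode_laplacian_def power2_eq_square map_poly_of_real_hom
  by (simp add: map_poly_pCons map_poly_of_real_hom)

text \<open>A root-free weight is a nonzero constant, so the equation becomes linear in
  \<open>g\<close>. Its coefficient at \<open>t^N\<close> and the coefficient of the weight at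
  \<open>t^(2*N)\<close> are incompatible.\<close>

lemma ode_p_laplacian_nonzero:
  fixes g :: "real poly" and r a b n :: real and d m :: nat
  assumes g: "g \<noteq> 0" and d: "d \<ge> 2" and m: "m > 0" and r: "2 * r + 1 > 0" "r \<noteq> 0"
    and ab: "\<bar>b\<bar> < a" and n: "n = a * real m + 2"
  shows "ode_p_laplacian r d m n a b g \<noteq> 0"
proof
  assume ode': "ode_p_laplacian r d m n a b g = 0"
  define w where "w = ode_weight (real d) (real m) g"
  \<comment> \<open>A real polynomial without real roots need not be constant, hence the complex
    copy of \<open>g\<close>.\<close>
  define G where "G = map_poly complex_of_real g"
  have ode: "ode_p_laplacian (of_real r) (of_nat d) (of_nat m) (of_real n) (of_real a) (of_real b) G = 0"
    using map_poly_ode_p_laplacian[of r d m n a b g] ode' by (simp add: G_def)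
  have G: "G \<noteq> 0" using g by (simp add: G_def map_poly_eq_0_iff)
  have wC: "map_poly complex_of_real w = ode_weight (of_nat d) (of_nat m) G"
    unfolding w_def ode_weight_def power2_eq_square map_poly_of_real_hom G_def
    by (simp add: map_poly_pCons map_poly_of_real_hom)
  have "d > 0" using d by simp
  then have nr: "poly (ode_weight (of_nat d) (of_nat m) G) z \<noteq> 0" for z
    using ode_weight_no_root[OF ode G _ m r ab] by blast
  then have "degree (ode_weight (of_nat d) (of_nat m) G) = 0"
    using fundamental_theorem_of_algebra constant_degree by blast
  then have degw: "degree w = 0"
    unfolding wC[symmetric] by (simp add: degree_map_poly)
  then obtain k where k: "w = [:k:]" by (rule degree_eq_zeroE)
  have "k \<noteq> 0" using nr[of 0] unfolding wC[symmetric] k by (simp add: map_poly_pCons)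
  define N where "N = degree g"
  define lc where "lc = coeff g N"
  have lc: "lc \<noteq> 0" using g by (simp add: lc_def N_def)
  have "[:k:] * (ode_laplacian d m n a b g + [:r:] * [:d * (2 * real d - 2):] * g)
      = ode_p_laplacian r d m n a b g"
    unfolding ode_p_laplacian_def w_def[symmetric] k by (simp add: algebra_simps)
  then have lin: "ode_laplacian d m n a b g + [:r:] * [:d * (2 * real d - 2):] * g = 0"
    using ode' \<open>k \<noteq> 0\<close> by simp
  have "0 = coeff (ode_laplacian d m n a b g + [:r:] * [:d * (2 * real d - 2):] * g) N"
    unfolding lin by simp
  also have "\<dots> = ((real m)^2 * (- real N * (real N - 1)) - (real m)^2 * (1 + a) * N
      + d * (d + n - 2) + r * (d * (2 * real d - 2))) * lc"
  proof -
    have h: "coeff g i = 0" if "i > N" for i using that unfolding N_def by (rule coeff_eq_0)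
    have x1: "coeff (pCons 0 (pderiv g)) N = N * lc"
      by (cases N) (auto simp: coeff_pCons coeff_pderiv lc_def)
    have x2: "coeff (pCons 0 (pCons 0 (pderiv (pderiv g)))) N = real N * (real N - 1) * lc"
      by (auto simp: coeff_pCons coeff_pderiv lc_def split: nat.splits)
    have x3: "coeff (pderiv g) N = 0" "coeff (pderiv (pderiv g)) N = 0"
      by (simp_all add: coeff_pderiv h)
    have e: "[:0,1:]^2 * p = pCons 0 (pCons 0 p)" for p :: "real poly"
      by (simp add: power2_eq_square)
    have f: "(1 - [:0,1:]^2) * p = p - pCons 0 (pCons 0 p)" for p :: "real poly"
      unfolding left_diff_distrib e by simp
    have cm: "coeff ([:k:] * p) j = k * coeff p j" for k :: real and p j by simp
    have y2: "coeff ((1 - [:0,1:]^2) * pderiv (pderiv g)) N = - (real N * (real N - 1) * lc)"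
      unfolding f using x2 x3 by simp
    have y1: "coeff ([:- b, 1 + a:] * pderiv g) N = (1 + a) * N * lc"
      using x1 x3 by (simp add: coeff_pCons coeff_pderiv split: nat.splits)
    show ?thesis
      unfolding ode_laplacian_def mult.assoc coeff_add coeff_diff cm y1 y2
      by (simp add: lc_def[symmetric] algebra_simps)
  qed
  finally have C: "(real m)^2 * (- real N * (real N - 1)) - (real m)^2 * (1 + a) * N
      + d * (d + n - 2) + r * (d * (2 * real d - 2)) = 0" using lc by simp
  \<comment> \<open>As \<open>n - 2 = a * m\<close>, the terms in \<open>N\<close> combine to
    \<open>m * N * (m * N + n - 2)\<close>, of the same shape as \<open>d * (d + n - 2)\<close>; so
    \<open>d = m * N\<close> will cancel both.\<close>
  have e1: "real m ^2 * N * N + real m * N * (n - 2) = d * (d + n - 2) + r * (d * (2 * real d - 2))"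
    using C unfolding n by (simp add: algebra_simps power2_eq_square)
  show False
  proof (cases "N = 0")
    case True
    have "0 < d * ((2 * r + 1) * (real d - 1) + a * m + 1)"
      using d r ab by (intro mult_pos_pos add_nonneg_pos add_nonneg_nonneg) auto
    also have "\<dots> = d * (d + n - 2) + r * (d * (2 * real d - 2))"
      unfolding n by (simp add: algebra_simps)
    finally show False using e1 True by simp
  next
    case False
    have "degree (pderiv g) \<le> N" "degree (pderiv g) < N" using False by (auto simp: degree_pderiv N_def)
    then have x: "degree (pCons 0 (pderiv g)) \<le> N" by (intro degree_pCons_le[THEN order_trans]) simp
    have x1: "coeff (pCons 0 (pderiv g)) N = N * lc"
      by (cases N) (auto simp: coeff_pCons coeff_pderiv lc_def)
    have x3: "coeff (pderiv g) N = 0" by (simp add: coeff_pderiv N_def coeff_eq_0)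
    have "0 = coeff w (N + N)" using degw False by (simp add: coeff_eq_0)
    also have "w = [:d^2:] * (g * g) + [:m^2:] * (pderiv g * pderiv g)
        - [:m^2:] * (pCons 0 (pderiv g) * pCons 0 (pderiv g))"
      unfolding w_def ode_weight_def by (simp add: power2_eq_square algebra_simps)
    also have "coeff \<dots> (N + N) = d^2 * lc^2 - m^2 * (N * lc)^2"
    proof -
      have cm: "coeff ([:k:] * p) j = k * coeff p j" for k :: real and p j by simp
      have "degree g \<le> N" by (simp add: N_def)
      note c = coeff_mult_degree_le[OF this this]
        coeff_mult_degree_le[OF \<open>degree (pderiv g) \<le> N\<close> \<open>degree (pderiv g) \<le> N\<close>]
        coeff_mult_degree_le[OF x x]
      show ?thesis
        unfolding coeff_diff coeff_add cm c x1 x3 by (simp add: lc_def power2_eq_square)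
    qed
    finally have "(real d)^2 = (real m * N)^2" using lc by (simp add: power_mult_distrib)
    then have "real d = real m * real N" by simp
    then have "r * (d * (2 * real d - 2)) = 0"
      using e1 by (simp add: algebra_simps power2_eq_square)
    then show False using r d by simp
  qed
qed

subsection \<open>Calculus of polynomial functions\<close>

text \<open>Since \<open>deriv\<close> is a choice operator, values of \<open>partial\<close> are
  obtained from a known Frechet derivative.\<close>

lemma partial_eqI:
  fixes f :: "real^'n::finite \<Rightarrow> real"
  assumes "(f has_derivative F) (at x)"
  shows "partial f i x = F (axis i 1)"
proof -
  have "((\<lambda>t. f (x + t *\<^sub>R axis i 1)) has_derivative (\<lambda>t. F (t *\<^sub>R axis i 1))) (at 0)"
    by (rule has_derivative_compose[of "\<lambda>t. x + t *\<^sub>R axis i 1" "\<lambda>t. t *\<^sub>R axis i 1" 0 UNIV f F])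
       (use assms in \<open>auto intro!: derivative_eq_intros\<close>)
  moreover have "F (t *\<^sub>R axis i 1) = F (axis i 1) * t" for t
    using assms has_derivative_linear linear_scale by fastforce
  ultimately have "((\<lambda>t. f (x + t *\<^sub>R axis i 1)) has_field_derivative F (axis i 1)) (at 0)"
    by (simp add: has_field_derivative_def)
  then show ?thesis unfolding partial_def by (rule DERIV_imp_deriv)
qed

lemma grad_nth [simp]: "grad f x $ i = partial f i x"
  by (simp add: grad_def)

lemma grad_eqI:
  fixes f :: "real^'n::finite \<Rightarrow> real"
  assumes "(f has_derivative (\<lambda>h. v \<bullet> h)) (at x)"
  shows "grad f x = v"
  by (simp add: vec_eq_iff partial_eqI[OF assms] inner_axis)

lemma has_derivative_grad:
  fixes f :: "real^'n::finite \<Rightarrow> real"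
  assumes "f differentiable (at x)"
  shows "(f has_derivative (\<lambda>h. grad f x \<bullet> h)) (at x)"
proof -
  obtain F where F: "(f has_derivative F) (at x)" using assms by (auto simp: differentiable_def)
  \<comment> \<open>Riesz representation: the adjoint of \<open>F\<close> at 1 is the representing
    vector.\<close>
  then have "F = (\<lambda>h. adjoint F 1 \<bullet> h)"
    using adjoint_works[OF has_derivative_linear[OF F], where y = 1] by (auto simp: inner_commute)
  then show ?thesis using grad_eqI F by metis
qed

lemma polyfun_has_grad:
  fixes f :: "real^'n::finite \<Rightarrow> real"
  assumes "real_polynomial_function f"
  shows "(f has_derivative (\<lambda>h. grad f x \<bullet> h)) (at x)"
  by (simp add: assms differentiable_at_real_polynomial_function has_derivative_grad)

lemma partial_linear:
  fixes f :: "real^'n::finite \<Rightarrow> real"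
  shows "bounded_linear f \<Longrightarrow> partial f i = (\<lambda>x. f (axis i 1))"
  using partial_eqI bounded_linear_imp_has_derivative by blast

lemma partial_const: "partial (\<lambda>x::real^'n::finite. c) i = (\<lambda>x. 0)"
  using partial_eqI[OF has_derivative_const] by blast

lemma partial_add:
  fixes f g :: "real^'n::finite \<Rightarrow> real"
  assumes "real_polynomial_function f" "real_polynomial_function g"
  shows "partial (\<lambda>x. f x + g x) i = (\<lambda>x. partial f i x + partial g i x)"
  using partial_eqI[OF has_derivative_add[OF polyfun_has_grad[OF assms(1)] polyfun_has_grad[OF assms(2)]]]
  by (auto simp: inner_axis)

lemma partial_mult:
  fixes f g :: "real^'n::finite \<Rightarrow> real"
  assumes "real_polynomial_function f" "real_polynomial_function g"
  shows "partial (\<lambda>x. f x * g x) i = (\<lambda>x. f x * partial g i x + partial f i x * g x)"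
  using partial_eqI[OF has_derivative_mult[OF polyfun_has_grad[OF assms(1)] polyfun_has_grad[OF assms(2)]]]
  by (auto simp: inner_axis)

lemma polyfun_partial:
  fixes f :: "real^'n::finite \<Rightarrow> real"
  assumes "real_polynomial_function f"
  shows "real_polynomial_function (partial f i)"
  using assms
  by (induction rule: real_polynomial_function.induct)
     (simp_all add: partial_linear partial_const partial_add partial_mult
       real_polynomial_function.intros)

text \<open>For polynomial functions the symmetry of the Hessian follows by induction from the
  product rule.\<close>

lemma partial_commute:
  fixes f :: "real^'n::finite \<Rightarrow> real"
  assumes "real_polynomial_function f"
  shows "partial (partial f i) j = partial (partial f j) i"
  using assms
proof (induction rule: real_polynomial_function.induct)
  case (mult f g)
  then show ?case
    by (simp add: partial_mult partial_add polyfun_partial real_polynomial_function.intros algebra_simps)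
qed (simp_all add: partial_linear partial_const partial_add polyfun_partial)

text \<open>On a line the gradient equations become identities of univariate polynomials, open to
  comparison of coefficients.\<close>

lemma polyfun_on_line:
  fixes f :: "'a::real_normed_vector \<Rightarrow> real"
  assumes "real_polynomial_function f"
  shows "\<exists>P. \<forall>s. poly P s = f (x + s *\<^sub>R v)"
  using assms
proof (induction rule: real_polynomial_function.induct)
  case (linear f)
  then have "poly [:f x, f v:] s = f (x + s *\<^sub>R v)" for s
    by (simp add: bounded_linear.linear linear_add linear_scale)
  then show ?case by blast
next
  case (const c)
  have "poly [:c:] s = c" for s by simp
  then show ?case by blast
qed (metis poly_add, metis poly_mult)

lemma hom_poly_polyfun:
  fixes u :: "real^'n::finite \<Rightarrow> real"
  assumes "hom_poly d u"
  shows "real_polynomial_function u"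
proof -
  obtain c where c: "u = (\<lambda>x. \<Sum>\<alpha>\<in>{\<alpha>. sum \<alpha> UNIV = d}. c \<alpha> * (\<Prod>i\<in>UNIV. (x $ i) ^ \<alpha> i))"
    using assms unfolding hom_poly_def by blast
  have *: "real_polynomial_function (\<lambda>x::real^'n. c \<alpha> * (\<Prod>i\<in>UNIV. (x $ i) ^ \<alpha> i))" for \<alpha>
    by (intro real_polynomial_function.intros(2,4) real_polynomial_function_prod
      real_polynomial_function_power real_polynomial_function.intros(1) bounded_linear_vec_nth finite)
  show ?thesis
  proof (cases "finite {\<alpha> :: 'n \<Rightarrow> nat. sum \<alpha> UNIV = d}")
    case True
    then show ?thesis unfolding c by (intro real_polynomial_function_sum *)
  next
    \<comment> \<open>A sum over an infinite set is 0 by convention, so finiteness of the index set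
      need not be shown.\<close>
    case False
    then show ?thesis unfolding c by (simp add: real_polynomial_function.intros(2))
  qed
qed

lemma hom_poly_scaleR:
  fixes u :: "real^'n::finite \<Rightarrow> real"
  assumes "hom_poly d u"
  shows "u (t *\<^sub>R x) = t ^ d * u x"
proof -
  obtain c where c: "u = (\<lambda>x. \<Sum>\<alpha>\<in>{\<alpha>. sum \<alpha> UNIV = d}. c \<alpha> * (\<Prod>i\<in>UNIV. (x $ i) ^ \<alpha> i))"
    using assms unfolding hom_poly_def by blast
  have "(\<Prod>i\<in>UNIV. ((t *\<^sub>R x) $ i) ^ \<alpha> i) = t ^ d * (\<Prod>i\<in>UNIV. (x $ i) ^ \<alpha> i)"
    if "sum \<alpha> UNIV = d" for \<alpha> :: "'n \<Rightarrow> nat"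
    by (simp add: power_mult_distrib prod.distrib power_sum[symmetric] that)
  then show ?thesis
    unfolding c sum_distrib_left by (intro sum.cong refl) (simp add: algebra_simps)
qed

text \<open>Both sides are the derivative of \<open>u (t *\<^sub>R x) = t ^ d * u x\<close> at
  \<open>t = 1\<close>.\<close>

lemma euler_grad:
  fixes u :: "real^'n::finite \<Rightarrow> real"
  assumes "hom_poly d u"
  shows "grad u x \<bullet> x = real d * u x"
proof -
  have "((\<lambda>t. u (t *\<^sub>R x)) has_derivative (\<lambda>t. grad u (1 *\<^sub>R x) \<bullet> (t *\<^sub>R x))) (at 1)"
    by (rule has_derivative_compose[of "\<lambda>t. t *\<^sub>R x" _ 1 UNIV u])
      (use polyfun_has_grad[OF hom_poly_polyfun[OF assms]] in \<open>auto intro!: derivative_eq_intros\<close>)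
  then have "((\<lambda>t. t ^ d * u x) has_real_derivative (grad u x \<bullet> x)) (at 1)"
    by (simp add: hom_poly_scaleR[OF assms] has_field_derivative_def mult_commute_abs)
  moreover have "((\<lambda>t. t ^ d * u x) has_real_derivative (real d * u x)) (at 1)"
    by (auto intro!: derivative_eq_intros)
  ultimately show ?thesis by (rule DERIV_unique)
qed

lemma norm_power_even: "norm x ^ (2 * m - 2) = (x \<bullet> x) ^ (m - 1)"
  by (simp add: power2_norm_eq_inner[symmetric] power_mult[symmetric] diff_mult_distrib2)

section \<open>First and second order consequences of the eikonal equation\<close>

locale eikonal_poly =
  fixes m :: nat and \<phi> :: "real^'n::finite \<Rightarrow> real"
  assumes m: "m > 0" and hom: "hom_poly m \<phi>"
    and eik: "(norm (grad \<phi> x))\<^sup>2 = (real m)\<^sup>2 * norm x ^ (2 * m - 2)"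
begin

lemma polyfun: "real_polynomial_function \<phi>"
  using hom by (rule hom_poly_polyfun)

lemma grad_inner_self: "grad \<phi> x \<bullet> grad \<phi> x = (real m)\<^sup>2 * (x \<bullet> x) ^ (m - 1)"
  using eik by (simp add: power2_norm_eq_inner norm_power_even)

lemmas euler = euler_grad[OF hom]

lemma grad_partial_inner: 
  "grad (partial \<phi> i) x \<bullet> h = (\<Sum>j\<in>UNIV. partial (partial \<phi> j) i x * h $ j)"
  by (simp add: inner_vec_def partial_commute[OF polyfun, of i])

text \<open>Differentiate Euler's identity for \<phi> in direction \<open>i\<close> and use the
  symmetry of the Hessian.\<close>

lemma euler_partial: "grad (partial \<phi> i) x \<bullet> x = real (m - 1) * partial \<phi> i x"
proof -
  have "((\<lambda>x. \<Sum>j\<in>UNIV. partial \<phi> j x * x $ j) has_derivative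
      (\<lambda>h. \<Sum>j\<in>UNIV. partial \<phi> j x * h $ j + (grad (partial \<phi> j) x \<bullet> h) * x $ j)) (at x)"
    by (intro has_derivative_sum has_derivative_mult polyfun_has_grad polyfun_partial polyfun
        bounded_linear_imp_has_derivative bounded_linear_vec_nth)
  moreover have "(\<lambda>x. \<Sum>j\<in>UNIV. partial \<phi> j x * x $ j) = (\<lambda>x. real m * \<phi> x)"
    using euler by (simp add: inner_vec_def)
  ultimately have A: "((\<lambda>x. real m * \<phi> x) has_derivative
      (\<lambda>h. \<Sum>j\<in>UNIV. partial \<phi> j x * h $ j + (grad (partial \<phi> j) x \<bullet> h) * x $ j)) (at x)"
    by simp
  have B: "((\<lambda>x. real m * \<phi> x) has_derivative (\<lambda>h. real m * (grad \<phi> x \<bullet> h))) (at x)"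
    by (intro has_derivative_mult_right polyfun_has_grad polyfun)
  have "(\<Sum>j\<in>UNIV. partial \<phi> j x * axis i 1 $ j + (grad (partial \<phi> j) x \<bullet> axis i 1) * x $ j)
      = real m * (grad \<phi> x \<bullet> axis i 1)"
    using partial_eqI[OF A, of i] partial_eqI[OF B, of i] by (rule trans[OF sym])
  moreover have "(\<Sum>j\<in>UNIV. partial \<phi> j x * axis i 1 $ j) = partial \<phi> i x"
    by (simp add: axis_def if_distrib cong: if_cong)
  ultimately show ?thesis
    using m by (simp add: sum.distrib grad_partial_inner inner_axis of_nat_diff algebra_simps)
qed

text \<open>This is half the derivative of the eikonal equation in direction \<open>i\<close>. The
  factor \<open>x \<bullet> x\<close> avoids the exponent \<open>m - 2\<close>.\<close>

lemma hessian_grad: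
  "(x \<bullet> x) * (grad (partial \<phi> i) x \<bullet> grad \<phi> x) = (real m)\<^sup>2 * real (m - 1) * (x \<bullet> x) ^ (m - 1) * x $ i"
proof -
  have "((\<lambda>x. \<Sum>j\<in>UNIV. partial \<phi> j x * partial \<phi> j x) has_derivative
      (\<lambda>h. \<Sum>j\<in>UNIV. partial \<phi> j x * (grad (partial \<phi> j) x \<bullet> h) + (grad (partial \<phi> j) x \<bullet> h) * partial \<phi> j x)) (at x)"
    by (intro has_derivative_sum has_derivative_mult polyfun_has_grad polyfun_partial polyfun)
  moreover have "(\<lambda>x. \<Sum>j\<in>UNIV. partial \<phi> j x * partial \<phi> j x) = (\<lambda>x. (real m)\<^sup>2 * (x \<bullet> x) ^ (m - 1))"
    using grad_inner_self by (simp add: inner_vec_def)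
  ultimately have A: "((\<lambda>x. (real m)\<^sup>2 * (x \<bullet> x) ^ (m - 1)) has_derivative
      (\<lambda>h. \<Sum>j\<in>UNIV. partial \<phi> j x * (grad (partial \<phi> j) x \<bullet> h) + (grad (partial \<phi> j) x \<bullet> h) * partial \<phi> j x)) (at x)"
    by simp
  have B: "((\<lambda>x. (real m)\<^sup>2 * (x \<bullet> x) ^ (m - 1)) has_derivative
      (\<lambda>h. (real m)\<^sup>2 * (real (m - 1) * (2 * (x \<bullet> h)) * (x \<bullet> x) ^ (m - 1 - 1)))) (at x)"
    by (auto intro!: derivative_eq_intros simp: inner_commute)
  have "(\<Sum>j\<in>UNIV. partial \<phi> j x * (grad (partial \<phi> j) x \<bullet> axis i 1) + (grad (partial \<phi> j) x \<bullet> axis i 1) * partial \<phi> j x)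
      = (real m)\<^sup>2 * (real (m - 1) * (2 * (x \<bullet> axis i 1)) * (x \<bullet> x) ^ (m - 1 - 1))"
    using partial_eqI[OF A, of i] partial_eqI[OF B, of i] by (rule trans[OF sym])
  then have G: "grad (partial \<phi> i) x \<bullet> grad \<phi> x = (real m)\<^sup>2 * (real (m - 1) * x $ i * (x \<bullet> x) ^ (m - 1 - 1))"
    by (simp add: sum.distrib grad_partial_inner inner_axis mult.commute sum_distrib_left[symmetric])
  \<comment> \<open>For \<open>m = 1\<close> the truncated exponent is 0, but then the factor
    \<open>m - 1\<close> vanishes.\<close>
  have P: "real (m - 1) * (x \<bullet> x) ^ (m - 1) = real (m - 1) * ((x \<bullet> x) * (x \<bullet> x) ^ (m - 1 - 1))"
    by (cases "m - 1") auto
  have "(x \<bullet> x) * (grad (partial \<phi> i) x \<bullet> grad \<phi> x)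
      = (real m)\<^sup>2 * x $ i * (real (m - 1) * ((x \<bullet> x) * (x \<bullet> x) ^ (m - 1 - 1)))"
    unfolding G by (simp only: ac_simps)
  then show ?thesis unfolding P[symmetric] by (simp only: ac_simps)
qed

end

subsection \<open>Great circles along the gradient\<close>

text \<open>If all coefficients up to index \<open>l\<close> vanish, the coefficient of the equation
  at \<open>l\<close> reduces to \<open>coeff R 0 * (l + 1)\<close> times the next coefficient of
  \<open>E i\<close>, which must vanish in characteristic 0.\<close>

lemma poly_linear_ode_unique:
  fixes E :: "'i::finite \<Rightarrow> 'a::{idom,ring_char_0} poly"
  assumes ode: "\<And>i. R * pderiv (E i) = (\<Sum>j\<in>UNIV. S i j * E j)"
    and R: "coeff R 0 \<noteq> 0" and E0: "\<And>i. coeff (E i) 0 = 0"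
  shows "E i = 0"
proof -
  have "\<forall>i. coeff (E i) k = 0" for k
  proof (induction k rule: less_induct)
    case (less k)
    show ?case
    proof (cases k)
      case (Suc l)
      have le: "coeff (E i) j = 0" if "j \<le> l" for i j using less Suc that by auto
      show ?thesis
      proof
        fix i
        have "coeff (S i j * E j) l = 0" for j
          unfolding coeff_mult by (intro sum.neutral) (simp add: le)
        then have "0 = coeff (R * pderiv (E i)) l" unfolding ode coeff_sum by simp
        also have "\<dots> = (\<Sum>j\<le>l. coeff R j * coeff (pderiv (E i)) (l - j))" by (rule coeff_mult)
        also have "\<dots> = (\<Sum>j\<in>{0}. coeff R j * coeff (pderiv (E i)) (l - j))"
          by (intro sum.mono_neutral_right) (auto simp: coeff_pderiv le Suc_diff_le[symmetric])
        also have "\<dots> = coeff R 0 * of_nat (Suc l) * coeff (E i) k" by (simp add: coeff_pderiv Suc)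
        finally show "coeff (E i) k = 0" using R by (simp del: of_nat_Suc)
      qed
    qed (simp add: E0)
  qed
  then show ?thesis by (simp add: poly_eq_iff)
qed

text \<open>The two differential equations are the real and imaginary parts of
  \<open>(1 + s^2) * F' = k * (s - \<i>) * F\<close> for
  \<open>F = c * (1 - \<i> * s)^k\<close>.\<close>

lemma complex_power_real_imag_polys:
  obtains A B :: "real poly"
  where "\<And>s. Complex (poly A s) (poly B s) = c * Complex 1 (- s) ^ k"
    and "\<And>s. (1 + s^2) * poly (pderiv A) s = real k * (poly B s + s * poly A s)"
    and "\<And>s. (1 + s^2) * poly (pderiv B) s = real k * (s * poly B s - poly A s)"
proof -
  have "\<exists>A B. \<forall>s. Complex (poly A s) (poly B s) = c * Complex 1 (- s) ^ k
      \<and> (1 + s^2) * poly (pderiv A) s = real k * (poly B s + s * poly A s)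
      \<and> (1 + s^2) * poly (pderiv B) s = real k * (s * poly B s - poly A s)"
  proof (induction k)
    case 0
    show ?case by (rule exI[of _ "[:Re c:]"], rule exI[of _ "[:Im c:]"]) (simp add: pderiv_pCons)
  next
    case (Suc k)
    then obtain A B where
      AB: "\<And>s. Complex (poly A s) (poly B s) = c * Complex 1 (- s) ^ k"
      and A': "\<And>s. (1 + s^2) * poly (pderiv A) s = real k * (poly B s + s * poly A s)"
      and B': "\<And>s. (1 + s^2) * poly (pderiv B) s = real k * (s * poly B s - poly A s)" by blast
    show ?case
    proof (rule exI[of _ "A + [:0,1:] * B"], rule exI[of _ "B - [:0,1:] * A"], intro allI conjI)
      fix s
      have "Complex (poly (A + [:0,1:] * B) s) (poly (B - [:0,1:] * A) s)
          = Complex (poly A s) (poly B s) * Complex 1 (- s)"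
        by (simp add: complex_eq_iff algebra_simps)
      then show "Complex (poly (A + [:0,1:] * B) s) (poly (B - [:0,1:] * A) s) = c * Complex 1 (- s) ^ Suc k"
        unfolding AB power_Suc by (simp only: ac_simps)
      have dA: "poly (pderiv (A + [:0,1:] * B)) s = poly (pderiv A) s + poly B s + s * poly (pderiv B) s"
        and dB: "poly (pderiv (B - [:0,1:] * A)) s = poly (pderiv B) s - poly A s - s * poly (pderiv A) s"
        by (simp_all add: pderiv_add pderiv_diff pderiv_pCons)
      show "(1 + s^2) * poly (pderiv (A + [:0,1:] * B)) s
          = real (Suc k) * (poly (B - [:0,1:] * A) s + s * poly (A + [:0,1:] * B) s)"
        unfolding dA using A'[of s] B'[of s] by (simp add: ring_distribs) algebra
      show "(1 + s^2) * poly (pderiv (B - [:0,1:] * A)) s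
          = real (Suc k) * (s * poly (B - [:0,1:] * A) s - poly (A + [:0,1:] * B) s)"
        unfolding dB using A'[of s] B'[of s] by (simp add: ring_distribs) algebra
    qed
  qed
  then show ?thesis using that by blast
qed

text \<open>One component of the equation for the deviation: \<open>p\<close>, \<open>x\<close>,
  \<open>v\<close> are components of the gradient, the base point and the direction. By
  \<open>N\<close>, the inhomogeneous term with \<open>M * W\<close> is absorbed by the
  model.\<close>

lemma circle_ode_identity:
  fixes a b a' b' p p' x v s k M W :: real
  assumes N: "a^2 + b^2 = M * W"
    and a: "(1 + s^2) * a' = k * (b + s * a)" and b: "(1 + s^2) * b' = k * (s * b - a)"
  shows "- (1 + s^2) * k * a * (p - x * a - v * b) - M * k * W * (x + s * v)
      + (1 + s^2) * a * (k * p - s * p') + (1 + s^2) * b * p'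
    = (1 + s^2) * (b - s * a) * (p' - x * a' - v * b')"
proof -
  have "(1 + s^2) * (b - s * a) * (p' - x * a' - v * b')
      = (1 + s^2) * (b - s * a) * p' - (b - s * a) * (x * ((1 + s^2) * a') + v * ((1 + s^2) * b'))"
    by (simp add: algebra_simps)
  moreover have "M * k * W * (x + s * v) = k * (a^2 + b^2) * (x + s * v)"
    unfolding N by simp
  ultimately show ?thesis unfolding a b by (simp add: algebra_simps power2_eq_square)
qed

context eikonal_poly
begin

text \<open>The eikonal equation determines \<open>\<nabla>\<phi>\<close> along the line: differentiating it gives
  \<open>H\<nabla>\<phi> = m\<^sup>2(m - 1)|x|\<^sup>2\<^sup>m\<^sup>-\<^sup>4 x\<close> for the Hessian \<open>H\<close>. So the deviation \<open>E\<close> of \<open>\<nabla>\<phi>\<close> from its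
  planar model \<open>A x + B \<nu>\<close>, \<open>A + \<i>B = m e\<^sup>i\<^sup>\<delta> (1 - \<i>s)\<^sup>m\<^sup>-\<^sup>1\<close>, solves a linear homogeneous ODE that is
  regular at \<open>s = 0\<close> because \<open>sin \<delta> \<noteq> 0\<close>.\<close>

lemma on_line_tangent_to_grad:
  assumes x: "x \<bullet> x = 1" "\<nu> \<bullet> \<nu> = 1" "x \<bullet> \<nu> = 0"
    and gr: "grad \<phi> x = (m * cos \<delta>) *\<^sub>R x + (m * sin \<delta>) *\<^sub>R \<nu>" and "sin \<delta> \<noteq> 0"
  shows "\<phi> (x + s *\<^sub>R \<nu>) = Re (cis \<delta> * Complex 1 (- s) ^ m)"
proof -
  define k where "k = m - 1"
  have mk: "m = Suc k" using m by (simp add: k_def)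
  obtain A B :: "real poly" where
    AB: "\<And>s. Complex (poly A s) (poly B s) = (m * cis \<delta>) * Complex 1 (- s) ^ k"
    and A': "\<And>s. (1 + s^2) * poly (pderiv A) s = real k * (poly B s + s * poly A s)"
    and B': "\<And>s. (1 + s^2) * poly (pderiv B) s = real k * (s * poly B s - poly A s)"
    using complex_power_real_imag_polys[of "m * cis \<delta>" k] by metis
  \<comment> \<open>The planar model satisfies the eikonal equation along the line.\<close>
  have N: "(poly A s)^2 + (poly B s)^2 = (real m)^2 * (1 + s^2)^k" for s
  proof -
    have "(poly A s)^2 + (poly B s)^2 = (norm (Complex (poly A s) (poly B s)))^2"
      by (simp add: cmod_power2)
    also have "\<dots> = (real m)^2 * ((norm (Complex 1 (- s)))^2)^k"
      unfolding AB by (simp add: norm_mult norm_power power_mult_distrib power_mult[symmetric] mult.commute)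
    finally show ?thesis by (simp add: cmod_power2)
  qed
  have "\<forall>i. \<exists>P. \<forall>s. poly P s = partial \<phi> i (x + s *\<^sub>R \<nu>)"
    using polyfun_on_line[OF polyfun_partial[OF polyfun]] by blast
  then obtain P where P: "\<And>i s. poly (P i) s = partial \<phi> i (x + s *\<^sub>R \<nu>)" by metis
  have "\<forall>i j. \<exists>Q. \<forall>s. poly Q s = partial (partial \<phi> i) j (x + s *\<^sub>R \<nu>)"
    using polyfun_on_line[OF polyfun_partial[OF polyfun_partial[OF polyfun]]] by blast
  then obtain Q where Q: "\<And>i j s. poly (Q i j) s = partial (partial \<phi> i) j (x + s *\<^sub>R \<nu>)" by metis
  have P': "poly (pderiv (P i)) s = grad (partial \<phi> i) (x + s *\<^sub>R \<nu>) \<bullet> \<nu>" for i s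
  proof -
    have "((\<lambda>s. partial \<phi> i (x + s *\<^sub>R \<nu>)) has_derivative
        (\<lambda>t. grad (partial \<phi> i) (x + s *\<^sub>R \<nu>) \<bullet> (t *\<^sub>R \<nu>))) (at s)"
      by (rule has_derivative_compose[of "\<lambda>t. x + t *\<^sub>R \<nu>" _ s UNIV "partial \<phi> i"])
        (use polyfun_has_grad[OF polyfun_partial[OF polyfun]] in \<open>auto intro!: derivative_eq_intros\<close>)
    moreover have "(\<lambda>s. partial \<phi> i (x + s *\<^sub>R \<nu>)) = poly (P i)" by (simp add: P fun_eq_iff)
    ultimately have "(poly (P i) has_real_derivative grad (partial \<phi> i) (x + s *\<^sub>R \<nu>) \<bullet> \<nu>) (at s)"
      by (simp add: has_field_derivative_def mult_commute_abs)
    then show ?thesis using poly_DERIV DERIV_unique by blast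
  qed
  define X :: "real poly" where "X = [:0,1:]"
  have X: "poly X s = s" for s by (simp add: X_def)
  define E where "E i = P i - smult (x $ i) A - smult (\<nu> $ i) B" for i
  \<comment> \<open>With \<open>P' = H \<nu>\<close>, Euler gives
    \<open>H x = k * P - s * P'\<close>. So \<open>P'\<close> enters \<open>H E\<close> with factor
    \<open>- (B - s * A)\<close> and \<open>P\<close> with \<open>- k * A\<close>, which dictates
    \<open>R\<close> and \<open>S\<close>; multiplying by \<open>1 + s^2\<close> clears
    denominators.\<close>
  define R where "R = (1 + X^2) * (B - X * A)"
  define S where "S i j = - (1 + X^2) * ((if i = j then of_nat k * A else 0) + Q i j)" for i j
  have "R * pderiv (E i) = (\<Sum>j\<in>UNIV. S i j * E j)" for i
  proof -
    have "poly (R * pderiv (E i)) s = poly (\<Sum>j\<in>UNIV. S i j * E j) s" for s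
    proof -
      let ?z = "x + s *\<^sub>R \<nu>"
      let ?a = "poly A s" and ?b = "poly B s" and ?H = "\<lambda>h. grad (partial \<phi> i) ?z \<bullet> h"
      have zz: "?z \<bullet> ?z = 1 + s^2"
        using x by (simp add: inner_add_left inner_add_right inner_commute power2_eq_square)
      have HE: "(\<Sum>j\<in>UNIV. poly (Q i j) s * poly (E j) s) = ?H (grad \<phi> ?z) - ?a * ?H x - ?b * ?H \<nu>"
        by (simp add: inner_vec_def Q E_def P sum_subtractf[symmetric] sum_distrib_left algebra_simps)
      have Hx: "?H x = real k * poly (P i) s - s * poly (pderiv (P i)) s"
        using euler_partial[of i ?z] by (simp add: inner_add_right P P' k_def)
      have H\<nu>: "?H \<nu> = poly (pderiv (P i)) s" by (simp add: P')
      have HG: "(1 + s^2) * ?H (grad \<phi> ?z) = (real m)^2 * real k * (1 + s^2)^k * (x $ i + s * \<nu> $ i)"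
        using hessian_grad[of ?z i] by (simp add: zz k_def)
      have "poly (\<Sum>j\<in>UNIV. S i j * E j) s = - (1 + s^2) *
          (real k * ?a * poly (E i) s + (\<Sum>j\<in>UNIV. poly (Q i j) s * poly (E j) s))"
      proof -
        have sj: "poly (S i j * E j) s = (if i = j then - (1 + s^2) * (real k * ?a * poly (E i) s) else 0)
            + - (1 + s^2) * (poly (Q i j) s * poly (E j) s)" for j
          by (simp add: S_def X algebra_simps)
        show ?thesis
          unfolding poly_sum sj sum.distrib sum_distrib_left[symmetric] by (simp add: algebra_simps)
      qed
      also have "\<dots> = - (1 + s^2) * real k * ?a * poly (E i) s - (1 + s^2) * ?H (grad \<phi> ?z)
          + (1 + s^2) * ?a * ?H x + (1 + s^2) * ?b * ?H \<nu>"
        unfolding HE by (simp add: algebra_simps)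
      also have "\<dots> = (1 + s^2) * (?b - s * ?a) * poly (pderiv (E i)) s"
      proof -
        have e: "poly (E i) s = poly (P i) s - x $ i * ?a - \<nu> $ i * ?b"
          "poly (pderiv (E i)) s = poly (pderiv (P i)) s - x $ i * poly (pderiv A) s - \<nu> $ i * poly (pderiv B) s"
          by (simp_all add: E_def pderiv_diff pderiv_smult)
        show ?thesis
          unfolding HG Hx H\<nu> e
          by (rule circle_ode_identity[OF N[of s] A'[of s] B'[of s]])
      qed
      finally show ?thesis by (simp add: R_def X)
    qed
    then show ?thesis using poly_eq_poly_eq_iff by blast
  qed
  moreover have c0: "poly A 0 = m * cos \<delta>" "poly B 0 = m * sin \<delta>"
    using AB[of 0] by (auto simp: complex_eq_iff one_complex.code[symmetric])
  then have "coeff R 0 \<noteq> 0"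
    using m \<open>sin \<delta> \<noteq> 0\<close> by (simp add: R_def poly_0_coeff_0[symmetric] X)
  moreover have "coeff (E i) 0 = 0" for i
    using arg_cong[OF gr, of "\<lambda>v. v $ i"] by (simp add: poly_0_coeff_0[symmetric] E_def P c0)
  ultimately have "E i = 0" for i by (rule poly_linear_ode_unique)
  then have "poly (P i) s = x $ i * poly A s + \<nu> $ i * poly B s" for i
  proof -
    from \<open>E i = 0\<close> have "poly (E i) s = poly 0 s" by (simp only:)
    then show ?thesis by (simp add: E_def)
  qed
  then have G: "grad \<phi> (x + s *\<^sub>R \<nu>) = poly A s *\<^sub>R x + poly B s *\<^sub>R \<nu>"
    by (simp add: vec_eq_iff P mult.commute)
  \<comment> \<open>Euler's identity recovers \<phi> from its gradient.\<close>
  have "m * \<phi> (x + s *\<^sub>R \<nu>) = poly A s + s * poly B s"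
    unfolding euler[symmetric] G using x by (simp add: inner_add_left inner_add_right inner_commute)
  also have "\<dots> = Re (Complex (poly A s) (poly B s) * Complex 1 (- s))" by simp
  also have "\<dots> = m * Re (cis \<delta> * Complex 1 (- s) ^ m)"
    unfolding AB mk by (simp add: mult.assoc mult.commute[of "Complex 1 (- s)"])
  finally show ?thesis using m by simp
qed

text \<open>Cauchy-Schwarz for the gradient, of length \<open>m\<close>, and \<open>x\<close>, with
  inner product \<open>m * \<phi> x\<close>.\<close>

lemma abs_le_1_on_sphere:
  assumes "x \<bullet> x = 1" shows "\<bar>\<phi> x\<bar> \<le> 1"
proof -
  have "(grad \<phi> x \<bullet> x)^2 \<le> (grad \<phi> x \<bullet> grad \<phi> x) * (x \<bullet> x)" by (rule Cauchy_Schwarz_ineq)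
  then have "(\<phi> x)^2 \<le> 1" using m by (simp add: euler grad_inner_self assms power_mult_distrib)
  then show ?thesis by (simp add: abs_square_le_1)
qed

text \<open>Otherwise \<open>\<phi>\<^sup>2 = |x|\<^sup>2\<^sup>m\<close>, whose Laplacian contradicts the bound.\<close>

lemma exists_noncritical:
  assumes lap: "\<And>x. x \<bullet> x = 1 \<Longrightarrow> \<bar>laplacian \<phi> x\<bar> < m * (real m + CARD('n) - 2)"
  shows "\<exists>x. x \<bullet> x = 1 \<and> \<bar>\<phi> x\<bar> < 1"
proof (rule ccontr)
  assume "\<not> ?thesis"
  then have one: "(\<phi> x)^2 = 1" if "x \<bullet> x = 1" for x
    using abs_le_1_on_sphere[OF that] that power2_eq_1_iff by force
  have sq: "\<phi> x * \<phi> x = (x \<bullet> x) ^ m" for x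
  proof (cases "x = 0")
    case True
    then show ?thesis using hom_poly_scaleR[OF hom, of 0 x] m by (simp add: zero_power)
  next
    case False
    let ?y = "(1 / norm x) *\<^sub>R x"
    have y: "?y \<bullet> ?y = 1" using False by (simp add: power2_norm_eq_inner[symmetric] power2_eq_square)
    have "\<phi> x = norm x ^ m * \<phi> ?y"
      using False hom_poly_scaleR[OF hom, of "norm x" ?y] by simp
    then have "(\<phi> x)^2 = ((norm x)^2)^m"
      by (simp add: power_mult_distrib one[OF y] power_mult[symmetric] mult.commute)
    then show ?thesis by (simp add: power2_norm_eq_inner power2_eq_square[of "\<phi> x"])
  qed
  have D1: "\<phi> x * partial \<phi> i x = m * ((x \<bullet> x) ^ (m - 1) * x $ i)" for x i
  proof -
    have "((\<lambda>x. (x \<bullet> x) ^ m) has_derivative (\<lambda>h. real m * (2 * (x \<bullet> h)) * (x \<bullet> x) ^ (m - 1))) (at x)"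
      by (auto intro!: derivative_eq_intros simp: inner_commute)
    from partial_eqI[OF this, of i] have "partial (\<lambda>x. \<phi> x * \<phi> x) i x = real m * (2 * x $ i) * (x \<bullet> x) ^ (m - 1)"
      by (simp add: sq inner_axis)
    then show ?thesis by (simp add: partial_mult polyfun algebra_simps)
  qed
  \<comment> \<open>Any unit vector serves; \<open>undefined\<close> is an arbitrary coordinate
    index.\<close>
  define x :: "real^'n" where "x = axis undefined 1"
  have x: "x \<bullet> x = 1" by (simp add: x_def inner_axis_axis)
  have D2: "partial \<phi> i x * partial \<phi> i x + \<phi> x * partial (partial \<phi> i) i x
      = 2 * m * real (m - 1) * (x $ i * x $ i) + m" for i
  proof -
    have "((\<lambda>x. m * ((x \<bullet> x) ^ (m - 1) * x $ i)) has_derivative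
        (\<lambda>h. m * ((x \<bullet> x) ^ (m - 1) * h $ i + real (m - 1) * (2 * (x \<bullet> h)) * (x \<bullet> x) ^ (m - 1 - 1) * x $ i))) (at x)"
      by (auto intro!: derivative_eq_intros bounded_linear_imp_has_derivative bounded_linear_vec_nth simp: inner_commute)
    from partial_eqI[OF this, of i] 
    have "partial (\<lambda>x. \<phi> x * partial \<phi> i x) i x = m * (1 + real (m - 1) * (2 * x $ i) * x $ i)"
      by (simp add: D1 inner_axis x)
    then show ?thesis by (simp add: partial_mult polyfun_partial polyfun algebra_simps)
  qed
  \<comment> \<open>The trace of \<open>D2\<close>, that is, half the Laplacian of
    \<open>\<phi>^2\<close> at a unit vector.\<close>
  have "(\<Sum>i\<in>UNIV. partial \<phi> i x * partial \<phi> i x) + \<phi> x * laplacian \<phi> x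
      = 2 * m * real (m - 1) * (\<Sum>i\<in>UNIV. x $ i * x $ i) + m * CARD('n)"
    unfolding laplacian_def sum_distrib_left sum.distrib[symmetric] D2
    by (simp add: sum.distrib sum_distrib_left[symmetric])
  moreover have "(\<Sum>i\<in>UNIV. partial \<phi> i x * partial \<phi> i x) = (real m)^2"
    using grad_inner_self[of x] by (simp add: inner_vec_def x[unfolded inner_vec_def, simplified])
  moreover have "(\<Sum>i\<in>UNIV. x $ i * x $ i) = 1" using x by (simp add: inner_vec_def)
  ultimately have "\<phi> x * laplacian \<phi> x = m * (real m + CARD('n) - 2)"
    using m by (simp add: of_nat_diff algebra_simps power2_eq_square)
  then have "\<bar>\<phi> x\<bar> * \<bar>laplacian \<phi> x\<bar> \<ge> m * (real m + CARD('n) - 2)"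
    by (simp add: abs_mult[symmetric])
  moreover have "\<bar>\<phi> x\<bar> * \<bar>laplacian \<phi> x\<bar> \<le> \<bar>laplacian \<phi> x\<bar>"
    using abs_le_1_on_sphere[OF x] by (simp add: mult_left_le_one_le)
  ultimately show False using lap[OF x] by linarith
qed

text \<open>The formula on the line tangent to the gradient extends to the spanned plane by
  homogeneity; a rotation within the plane then removes the phase \<delta>.\<close>

lemma great_circle:
  assumes x1: "x1 \<bullet> x1 = 1" "\<bar>\<phi> x1\<bar> < 1"
  obtains e w where "e \<bullet> e = 1" "w \<bullet> w = 1" "e \<bullet> w = 0"
    and "\<And>\<theta>. \<phi> (cos \<theta> *\<^sub>R e + sin \<theta> *\<^sub>R w) = cos (real m * \<theta>)"
proof -
  define \<delta> where "\<delta> = arccos (\<phi> x1)"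
  define x where "x = x1"
  have x: "x \<bullet> x = 1" using x1 by (simp add: x_def)
  have cd: "cos \<delta> = \<phi> x" using x1 by (simp add: \<delta>_def x_def cos_arccos_abs)
  have "\<delta> > 0" "\<delta> < pi" using x1 arccos_lt_bounded[of "\<phi> x1"] by (auto simp: \<delta>_def)
  then have sd: "sin \<delta> > 0" by (rule sin_gt_zero)
  \<comment> \<open>The normalised tangential part of the gradient; its length before normalising is
    \<open>m * sin \<delta>\<close>, by the eikonal equation.\<close>
  define \<nu> where "\<nu> = (1 / (m * sin \<delta>)) *\<^sub>R (grad \<phi> x - (m * cos \<delta>) *\<^sub>R x)"
  have gx: "grad \<phi> x \<bullet> x = m * cos \<delta>" by (simp add: euler cd)
  have xn: "x \<bullet> \<nu> = 0" by (simp add: \<nu>_def inner_diff_right inner_commute[of x "grad \<phi> x"] gx x)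
  have "(m * sin \<delta>)^2 = (real m)^2 - (m * cos \<delta>)^2"
    by (simp add: power_mult_distrib sin_squared_eq algebra_simps)
  then have "(grad \<phi> x - (m * cos \<delta>) *\<^sub>R x) \<bullet> (grad \<phi> x - (m * cos \<delta>) *\<^sub>R x) = (m * sin \<delta>)^2"
    by (simp add: inner_diff_left inner_diff_right inner_commute[of x "grad \<phi> x"] gx x grad_inner_self power2_eq_square)
  then have nn: "\<nu> \<bullet> \<nu> = 1" using m sd by (simp add: \<nu>_def power2_eq_square)
  have gr: "grad \<phi> x = (m * cos \<delta>) *\<^sub>R x + (m * sin \<delta>) *\<^sub>R \<nu>" using m sd by (simp add: \<nu>_def)
  have line: "\<phi> (x + s *\<^sub>R \<nu>) = Re (cis \<delta> * Complex 1 (- s) ^ m)" for s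
    using on_line_tangent_to_grad[OF x nn xn gr] sd by simp
  have plane: "\<phi> (X *\<^sub>R x + Y *\<^sub>R \<nu>) = Re (cis \<delta> * (of_real X - \<i> * of_real Y) ^ m)" (is "?f X = ?g X") for X Y
  proof -
    have ne: "?f X = ?g X" if "X \<noteq> 0" for X
    proof -
      have "?f X = \<phi> (X *\<^sub>R (x + (Y / X) *\<^sub>R \<nu>))" using that by (simp add: scaleR_add_right)
      also have "\<dots> = X^m * Re (cis \<delta> * Complex 1 (- (Y / X)) ^ m)"
        unfolding hom_poly_scaleR[OF hom] line ..
      also have "\<dots> = Re (of_real (X^m) * (cis \<delta> * Complex 1 (- (Y / X)) ^ m))"
        by (simp del: of_real_power)
      also have "of_real (X^m) * (cis \<delta> * Complex 1 (- (Y / X)) ^ m) = cis \<delta> * (of_real X * Complex 1 (- (Y / X))) ^ m"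
        by (simp add: power_mult_distrib)
      also have "of_real X * Complex 1 (- (Y / X)) = of_real X - \<i> * of_real Y"
        using that by (simp add: complex_eq_iff)
      finally show ?thesis .
    qed
    \<comment> \<open>Scaling the line misses the direction \<open>X = 0\<close>, which is reached
      by continuity of both sides.\<close>
    have cf: "?f \<midarrow>0\<rightarrow> ?f 0"
    proof -
      have "isCont \<phi> (0 *\<^sub>R x + Y *\<^sub>R \<nu>)"
        using polyfun_has_grad[OF polyfun] has_derivative_continuous by blast
      then show ?thesis by (intro isCont_tendsto_compose[of _ \<phi>] tendsto_intros)
    qed
    have cg: "?g \<midarrow>0\<rightarrow> ?g 0" by (intro tendsto_intros)
    have "?g \<midarrow>0\<rightarrow> ?f 0"
      by (rule Lim_transform_eventually[OF cf]) (auto simp: eventually_at_filter ne)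
    then have "?f 0 = ?g 0" using LIM_unique cg by blast
    then show ?thesis using ne by (cases "X = 0") auto
  qed
  \<comment> \<open>An angle \<epsilon> shifts the phase by \<open>m * \<epsilon>\<close>, which
    must equal \<delta>.\<close>
  define \<epsilon> where "\<epsilon> = \<delta> / m"
  show thesis
  proof (rule that[of "cos \<epsilon> *\<^sub>R x + sin \<epsilon> *\<^sub>R \<nu>" "cos \<epsilon> *\<^sub>R \<nu> - sin \<epsilon> *\<^sub>R x"])
    have s: "cos \<epsilon> * cos \<epsilon> + sin \<epsilon> * sin \<epsilon> = 1" by (metis sin_cos_squared_add3)
    show "(cos \<epsilon> *\<^sub>R x + sin \<epsilon> *\<^sub>R \<nu>) \<bullet> (cos \<epsilon> *\<^sub>R x + sin \<epsilon> *\<^sub>R \<nu>) = 1"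
      "(cos \<epsilon> *\<^sub>R \<nu> - sin \<epsilon> *\<^sub>R x) \<bullet> (cos \<epsilon> *\<^sub>R \<nu> - sin \<epsilon> *\<^sub>R x) = 1"
      "(cos \<epsilon> *\<^sub>R x + sin \<epsilon> *\<^sub>R \<nu>) \<bullet> (cos \<epsilon> *\<^sub>R \<nu> - sin \<epsilon> *\<^sub>R x) = 0"
      using x nn xn s by (simp_all add: inner_add_left inner_add_right inner_diff_left inner_diff_right inner_commute[of \<nu> x])
    fix \<theta>
    have "cos \<theta> *\<^sub>R (cos \<epsilon> *\<^sub>R x + sin \<epsilon> *\<^sub>R \<nu>) + sin \<theta> *\<^sub>R (cos \<epsilon> *\<^sub>R \<nu> - sin \<epsilon> *\<^sub>R x)
        = cos (\<theta> + \<epsilon>) *\<^sub>R x + sin (\<theta> + \<epsilon>) *\<^sub>R \<nu>"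
      by (simp add: cos_add sin_add algebra_simps)
    moreover have "of_real (cos (\<theta> + \<epsilon>)) - \<i> * of_real (sin (\<theta> + \<epsilon>)) = cis (- (\<theta> + \<epsilon>))"
      by (simp add: complex_eq_iff del: minus_add_distrib)
    moreover have "cis \<delta> * cis (- (\<theta> + \<epsilon>)) ^ m = cis (- (real m * \<theta>))"
      unfolding Complex.DeMoivre cis_mult
      by (rule arg_cong[of _ _ cis]) (use m in \<open>simp add: \<epsilon>_def field_simps\<close>)
    ultimately show "\<phi> (cos \<theta> *\<^sub>R (cos \<epsilon> *\<^sub>R x + sin \<epsilon> *\<^sub>R \<nu>) + sin \<theta> *\<^sub>R (cos \<epsilon> *\<^sub>R \<nu> - sin \<epsilon> *\<^sub>R x)) = cos (real m * \<theta>)"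
      by (simp add: plane)
  qed
qed

end

subsection \<open>Reduction to one variable\<close>

text \<open>These are the Chebyshev polynomials, built by their three-term recurrence.\<close>

lemma cos_multiple_poly: "\<exists>T. \<forall>x. cos (real n * x) = poly T (cos x)"
proof (induction n rule: induct_nat_012)
  case 0
  show ?case by (rule exI[of _ 1]) simp
next
  case 1
  show ?case by (rule exI[of _ "[:0,1:]"]) simp
next
  case (ge2 n)
  then obtain S T where ST: "\<And>x. cos (real n * x) = poly S (cos x)"
    "\<And>x. cos (real (Suc n) * x) = poly T (cos x)" by blast
  have "cos (real (Suc (Suc n)) * x) = poly ([:0,2:] * T - S) (cos x)" for x
  proof -
    have "cos (real (Suc (Suc n)) * x) + cos (real n * x) = 2 * cos x * cos (real (Suc n) * x)"
      using cos_add[of "real (Suc n) * x" x] cos_diff[of "real (Suc n) * x" x]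
      by (simp add: algebra_simps)
    then have "cos (real (Suc (Suc n)) * x) = 2 * cos x * cos (real (Suc n) * x) - cos (real n * x)"
      by linarith
    then show ?thesis unfolding ST by simp
  qed
  then show ?case by blast
qed

lemma cos_add_int_2pi: "cos (x + of_int i * (2 * pi)) = cos x"
  using cos_int_2pin[of i] sin_int_2pin[of i] by (simp add: cos_add mult.commute)

text \<open>Roots of unity filter: if \<open>m\<close> divides \<open>k\<close>, all summands agree
  and are Chebyshev polynomials in \<open>cos (m * \<theta>)\<close>; otherwise the geometric sum is
  0.\<close>

lemma sum_cos_rotations:
  fixes k :: int
  assumes "m > 0"
  shows "\<exists>g. \<forall>\<theta>. (\<Sum>j<m. cos (of_int k * (\<theta> + 2 * pi * real j / m))) = poly g (cos (real m * \<theta>))"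
proof (cases "int m dvd k")
  case True
  then obtain l where l: "k = int m * l" by blast
  obtain T where T: "\<And>x. cos (real (nat \<bar>l\<bar>) * x) = poly T (cos x)"
    using cos_multiple_poly by blast
  have "cos (of_int k * (\<theta> + 2 * pi * real j / m)) = poly T (cos (real m * \<theta>))" for \<theta> j
  proof -
    have "of_int k * (\<theta> + 2 * pi * real j / m) = of_int l * (real m * \<theta>) + of_int (l * int j) * (2 * pi)"
      using assms by (simp add: l field_simps)
    also have "cos \<dots> = cos (of_int l * (real m * \<theta>))"
      by (rule cos_add_int_2pi)
    also have "\<dots> = cos (real (nat \<bar>l\<bar>) * (m * \<theta>))"
      by (cases "l \<ge> 0") (auto simp: abs_if)
    finally show ?thesis unfolding T .
  qed
  then have "(\<Sum>j<m. cos (of_int k * (\<theta> + 2 * pi * real j / m))) = poly (smult (real m) T) (cos (real m * \<theta>))" for \<theta>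
    by simp
  then show ?thesis by blast
next
  case False
  define z where "z = cis (of_int k * (2 * pi / m))"
  have "z \<noteq> 1"
  proof
    assume "z = 1"
    then have "cos (of_int k * (2 * pi / m)) = 1" by (simp add: z_def complex_eq_iff)
    then obtain l :: int where "of_int k * (2 * pi / m) = of_int l * 2 * pi"
      unfolding cos_one_2pi_int by blast
    then have "real_of_int k = of_int (int m * l)" using assms by (simp add: field_simps)
    then have "k = int m * l" by linarith
    then show False using False by simp
  qed
  have "z ^ m = cis (of_int k * (2 * pi))" using assms by (simp add: z_def Complex.DeMoivre)
  also have "\<dots> = 1"
    using cos_int_2pin[of k] sin_int_2pin[of k] by (simp add: complex_eq_iff mult.commute)
  finally have zm: "z ^ m = 1" .
  have "(\<Sum>j<m. cos (of_int k * (\<theta> + 2 * pi * real j / m))) = 0" for \<theta>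
  proof -
    have "(\<Sum>j<m. cos (of_int k * (\<theta> + 2 * pi * real j / m))) = Re (\<Sum>j<m. cis (of_int k * \<theta>) * z ^ j)"
      by (auto simp: z_def Complex.DeMoivre cis_mult algebra_simps intro!: sum.cong)
    also have "(\<Sum>j<m. cis (of_int k * \<theta>) * z ^ j) = 0"
      using \<open>z \<noteq> 1\<close> by (simp add: sum_distrib_left[symmetric] geometric_sum zm)
    finally show ?thesis by simp
  qed
  then show ?thesis by (intro exI[of _ 0]) simp
qed

text \<open>The extra factor \<open>cos (k * x)\<close> carries the induction on \<open>P\<close>:
  multiplying it by \<open>cos x\<close> yields the frequencies \<open>k + 1\<close> and
  \<open>k - 1\<close>, so \<open>k\<close> ranges over the integers. The case \<open>k = 0\<close>
  is the one wanted.\<close>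

lemma sum_poly_cos_rotations:
  fixes P :: "real poly" and k :: int
  assumes "m > 0"
  shows "\<exists>g. \<forall>\<theta>. (\<Sum>j<m. poly P (cos (\<theta> + 2 * pi * real j / m)) * cos (of_int k * (\<theta> + 2 * pi * real j / m)))
    = poly g (cos (real m * \<theta>))"
proof (induction P arbitrary: k)
  case 0
  show ?case by (intro exI[of _ 0]) simp
next
  case (pCons a P)
  let ?t = "\<lambda>\<theta> j. \<theta> + 2 * pi * real j / m"
  obtain g0 where g0: "\<And>\<theta>. (\<Sum>j<m. cos (of_int k * ?t \<theta> j)) = poly g0 (cos (real m * \<theta>))"
    using sum_cos_rotations[OF assms, of k] by blast
  obtain g1 where g1: "\<And>\<theta>. (\<Sum>j<m. poly P (cos (?t \<theta> j)) * cos (of_int (k + 1) * ?t \<theta> j)) = poly g1 (cos (real m * \<theta>))"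
    using pCons.IH[of "k + 1"] by blast
  obtain g2 where g2: "\<And>\<theta>. (\<Sum>j<m. poly P (cos (?t \<theta> j)) * cos (of_int (k - 1) * ?t \<theta> j)) = poly g2 (cos (real m * \<theta>))"
    using pCons.IH[of "k - 1"] by blast
  have c: "cos x * cos (of_int k * x) = (cos (of_int (k + 1) * x) + cos (of_int (k - 1) * x)) / 2" for x :: real
    using cos_add[of "of_int k * x" x] cos_diff[of "of_int k * x" x] by (simp add: algebra_simps)
  have e: "poly (pCons a P) (cos x) * cos (of_int k * x) = a * cos (of_int k * x)
      + (poly P (cos x) * cos (of_int (k + 1) * x) + poly P (cos x) * cos (of_int (k - 1) * x)) / 2" for x
  proof -
    have "poly (pCons a P) (cos x) * cos (of_int k * x)
        = a * cos (of_int k * x) + poly P (cos x) * (cos x * cos (of_int k * x))"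
      by (simp add: algebra_simps)
    then show ?thesis unfolding c by (simp add: distrib_left add_divide_distrib)
  qed
  have "(\<Sum>j<m. poly (pCons a P) (cos (?t \<theta> j)) * cos (of_int k * ?t \<theta> j))
      = poly (smult a g0 + smult (1/2) (g1 + g2)) (cos (real m * \<theta>))" for \<theta>
    unfolding e sum.distrib sum_distrib_left[symmetric] sum_divide_distrib[symmetric] g0 g1 g2 by simp
  then show ?case by blast
qed

text \<open>Replacing \<open>sin^2\<close> by \<open>1 - cos^2\<close> keeps products at most linear
  in \<open>sin \<theta>\<close>.\<close>

lemma polyfun_on_circle:
  fixes u :: "'a::real_normed_vector \<Rightarrow> real"
  assumes "real_polynomial_function u"
  shows "\<exists>P Q. \<forall>\<theta>. u (cos \<theta> *\<^sub>R e + sin \<theta> *\<^sub>R w) = poly P (cos \<theta>) + sin \<theta> * poly Q (cos \<theta>)"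
  using assms
proof (induction rule: real_polynomial_function.induct)
  case (linear f)
  then have "f (cos \<theta> *\<^sub>R e + sin \<theta> *\<^sub>R w) = poly [:0, f e:] (cos \<theta>) + sin \<theta> * poly [:f w:] (cos \<theta>)" for \<theta>
    by (simp add: bounded_linear.linear linear_add linear_scale)
  then show ?case by blast
next
  case (const c)
  have "c = poly [:c:] (cos \<theta>) + sin \<theta> * poly 0 (cos \<theta>)" for \<theta> by simp
  then show ?case by blast
next
  case (add f g)
  then obtain P Q R S where
    f: "\<And>\<theta>. f (cos \<theta> *\<^sub>R e + sin \<theta> *\<^sub>R w) = poly P (cos \<theta>) + sin \<theta> * poly Q (cos \<theta>)" and
    g: "\<And>\<theta>. g (cos \<theta> *\<^sub>R e + sin \<theta> *\<^sub>R w) = poly R (cos \<theta>) + sin \<theta> * poly S (cos \<theta>)" by blast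
  show ?case
    by (rule exI[of _ "P + R"], rule exI[of _ "Q + S"]) (simp add: f g algebra_simps)
next
  case (mult f g)
  then obtain P Q R S where
    f: "\<And>\<theta>. f (cos \<theta> *\<^sub>R e + sin \<theta> *\<^sub>R w) = poly P (cos \<theta>) + sin \<theta> * poly Q (cos \<theta>)" and
    g: "\<And>\<theta>. g (cos \<theta> *\<^sub>R e + sin \<theta> *\<^sub>R w) = poly R (cos \<theta>) + sin \<theta> * poly S (cos \<theta>)" by blast
  have "(p + s * q) * (r + s * t) = (p * r + (1 - c^2) * (q * t)) + s * (p * t + q * r)"
    if "s^2 = 1 - c^2" for p q r s t c :: real
    unfolding that[symmetric] by (simp add: algebra_simps power2_eq_square)
  note e = this[OF sin_squared_eq]
  show ?case
    by (rule exI[of _ "P * R + (1 - [:0,1:]^2) * (Q * S)"], rule exI[of _ "P * S + Q * R"])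
      (simp add: f g e)
qed

text \<open>The restriction to the circle is even and \<open>2\<pi>/m\<close>-periodic, so averaging over the
  rotations by multiples of \<open>2\<pi>/m\<close> leaves only the frequencies divisible by \<open>m\<close>.\<close>

lemma dihedral_symmetric_poly:
  fixes u :: "'a::real_normed_vector \<Rightarrow> real"
  assumes u: "real_polynomial_function u" and "m > 0"
    and F: "\<And>\<theta>. u (cos \<theta> *\<^sub>R e + sin \<theta> *\<^sub>R w) = F (cos (real m * \<theta>))"
  shows "\<exists>g. \<forall>\<theta>. u (cos \<theta> *\<^sub>R e + sin \<theta> *\<^sub>R w) = poly g (cos (real m * \<theta>))"
proof -
  let ?h = "\<lambda>\<theta>. u (cos \<theta> *\<^sub>R e + sin \<theta> *\<^sub>R w)"
  obtain P Q where PQ: "\<And>\<theta>. ?h \<theta> = poly P (cos \<theta>) + sin \<theta> * poly Q (cos \<theta>)"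
    using polyfun_on_circle[OF u] by blast
  have P: "?h \<theta> = poly P (cos \<theta>)" for \<theta>
  proof -
    have "?h (- \<theta>) = ?h \<theta>" unfolding F by simp
    then show ?thesis using PQ[of \<theta>] PQ[of "- \<theta>"] by simp
  qed
  obtain g where g: "\<And>\<theta>. (\<Sum>j<m. poly P (cos (\<theta> + 2 * pi * real j / m))) = poly g (cos (real m * \<theta>))"
    using sum_poly_cos_rotations[OF \<open>m > 0\<close>, of P 0] by auto
  have "?h (\<theta> + 2 * pi * real j / m) = ?h \<theta>" for \<theta> j
  proof -
    have "m * (\<theta> + 2 * pi * real j / m) = m * \<theta> + real j * (2 * pi)"
      using \<open>m > 0\<close> by (simp add: field_simps)
    also have "cos \<dots> = cos (real m * \<theta>)"
      using cos_add_int_2pi[of "m * \<theta>" "int j"] by simp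
    finally show ?thesis unfolding F by (rule arg_cong)
  qed
  then have "m * ?h \<theta> = poly g (cos (real m * \<theta>))" for \<theta>
    unfolding g[symmetric] P by simp
  then have "?h \<theta> = poly (smult (1 / m) g) (cos (real m * \<theta>))" for \<theta>
    using \<open>m > 0\<close> by (simp add: field_simps)
  then show ?thesis by blast
qed

section \<open>Gradient and p-Laplacian of functions
  \<open>|x|^D * G (\<phi> / |x|^m)\<close>\<close>

context eikonal_poly
begin

text \<open>Real exponents of \<open>x \<bullet> x\<close> allow odd powers of the norm and the
  negative degrees that differentiation produces.\<close>

definition radial :: "real \<Rightarrow> real poly \<Rightarrow> real^'n \<Rightarrow> real" where
  "radial D G x = (x \<bullet> x) powr (D / 2) * poly G (\<phi> x * (x \<bullet> x) powr (- real m / 2))"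

lemma radial_mult: "radial C F x * radial D G x = radial (C + D) (F * G) x"
  by (simp add: radial_def add_divide_distrib powr_add)

lemma radial_add: "radial D F x + radial D G x = radial D (F + G) x"
  by (simp add: radial_def algebra_simps)

lemma radial_smult: "c * radial D G x = radial D (smult c G) x"
  by (simp add: radial_def algebra_simps)

lemma radial_unit [simp]: "x \<bullet> x = 1 \<Longrightarrow> radial D G x = poly G (\<phi> x)"
  by (simp add: radial_def)

lemma radial_base:
  assumes "x \<noteq> 0"
  shows "x \<bullet> x = radial 2 1 x" "(x \<bullet> x) ^ (m - 1) = radial (2 * real m - 2) 1 x" "\<phi> x = radial m [:0,1:] x"
proof -
  have e: "real (m - 1) = (2 * real m - 2) / 2" using m by (simp add: of_nat_diff field_simps)
  have "(x \<bullet> x) ^ (m - 1) = (x \<bullet> x) powr real (m - 1)"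
    using assms by (intro powr_realpow[symmetric]) simp
  then show "(x \<bullet> x) ^ (m - 1) = radial (2 * real m - 2) 1 x"
    unfolding e by (simp add: radial_def)
  show "x \<bullet> x = radial 2 1 x" using assms by (simp add: radial_def)
  show "\<phi> x = radial m [:0,1:] x" using assms by (simp add: radial_def powr_minus)
qed

text \<open>The factor of \<open>x\<close> in the gradient, collecting the derivatives of both
  powers of the norm.\<close>

definition radial_coeff :: "real \<Rightarrow> real poly \<Rightarrow> real poly" where
  "radial_coeff D G = smult D G - smult m ([:0,1:] * pderiv G)"

text \<open>The gradient is a combination of \<open>x\<close> and the gradient of \<phi> with radial
  coefficients, so differentiation can be repeated.\<close>

lemma radial_has_derivative:
  assumes "x \<noteq> 0"
  shows "(radial D G has_derivative
    (\<lambda>h. (radial (D - 2) (radial_coeff D G) x *\<^sub>R x + radial (D - m) (pderiv G) x *\<^sub>R grad \<phi> x) \<bullet> h)) (at x)"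
proof -
  define \<rho> where "\<rho> = x \<bullet> x"
  have \<rho>: "\<rho> > 0" "x \<bullet> x > 0" using assms by (simp_all add: \<rho>_def)
  have d\<rho>: "((\<lambda>x. x \<bullet> x) has_derivative (\<lambda>h. 2 * (x \<bullet> h))) (at x)"
    by (auto intro!: derivative_eq_intros simp: inner_commute)
  have dp: "((\<lambda>x. (x \<bullet> x) powr a) has_derivative (\<lambda>h. \<rho> powr a * (2 * (x \<bullet> h) * a / \<rho>))) (at x)" for a
    using has_derivative_powr[OF d\<rho> has_derivative_const, of a] \<rho> by (simp add: \<rho>_def)
  define q r where "q = \<rho> powr (- real m / 2)" and "r = \<rho> powr (D / 2)"
  define g g' where "g = poly G (\<phi> x * q)" and "g' = poly (pderiv G) (\<phi> x * q)"
  have dT: "((\<lambda>x. \<phi> x * (x \<bullet> x) powr (- real m / 2)) has_derivative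
      (\<lambda>h. \<phi> x * (q * (2 * (x \<bullet> h) * (- real m / 2) / \<rho>)) + (grad \<phi> x \<bullet> h) * q)) (at x)"
    unfolding q_def \<rho>_def by (rule has_derivative_mult[OF polyfun_has_grad[OF polyfun] dp[unfolded \<rho>_def]])
  have dG: "((\<lambda>x. poly G (\<phi> x * (x \<bullet> x) powr (- real m / 2))) has_derivative
      (\<lambda>h. g' * (\<phi> x * (q * (2 * (x \<bullet> h) * (- real m / 2) / \<rho>)) + (grad \<phi> x \<bullet> h) * q))) (at x)"
    by (rule has_derivative_compose[OF dT, of "poly G"])
       (use poly_DERIV[of G "\<phi> x * q"] in \<open>simp add: has_field_derivative_def g'_def q_def \<rho>_def\<close>)
  have "(radial D G has_derivative
    (\<lambda>h. r * (g' * (\<phi> x * (q * (2 * (x \<bullet> h) * (- real m / 2) / \<rho>)) + (grad \<phi> x \<bullet> h) * q))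
      + r * (2 * (x \<bullet> h) * (D / 2) / \<rho>) * g)) (at x)"
    unfolding radial_def[abs_def] using has_derivative_mult[OF dp dG, of "D / 2"]
    by (simp add: g_def r_def q_def \<rho>_def)
  also have "(\<lambda>h. r * (g' * (\<phi> x * (q * (2 * (x \<bullet> h) * (- real m / 2) / \<rho>)) + (grad \<phi> x \<bullet> h) * q))
      + r * (2 * (x \<bullet> h) * (D / 2) / \<rho>) * g) =
    (\<lambda>h. (radial (D - 2) (radial_coeff D G) x *\<^sub>R x + radial (D - m) (pderiv G) x *\<^sub>R grad \<phi> x) \<bullet> h)"
  proof
    fix h
    have "\<rho> powr ((D - 2) / 2) = r / \<rho>"
      using \<rho> by (simp add: r_def diff_divide_distrib powr_diff)
    then have 1: "radial (D - 2) (radial_coeff D G) x = r / \<rho> * (D * g - m * (\<phi> x * q * g'))"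
      by (simp add: radial_def radial_coeff_def \<rho>_def[symmetric] g_def g'_def q_def)
    have "\<rho> powr ((D - m) / 2) = r * q"
      by (simp add: r_def q_def diff_divide_distrib powr_add[symmetric])
    then have 2: "radial (D - m) (pderiv G) x = r * q * g'"
      by (simp add: radial_def \<rho>_def[symmetric] g'_def q_def)
    show "r * (g' * (\<phi> x * (q * (2 * (x \<bullet> h) * (- real m / 2) / \<rho>)) + (grad \<phi> x \<bullet> h) * q))
      + r * (2 * (x \<bullet> h) * (D / 2) / \<rho>) * g
      = (radial (D - 2) (radial_coeff D G) x *\<^sub>R x + radial (D - m) (pderiv G) x *\<^sub>R grad \<phi> x) \<bullet> h"
      unfolding 1 2 inner_add_left inner_scaleR_left using \<rho>(1) by (simp add: field_simps)
  qed
  finally show ?thesis .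
qed

lemmas radial_grad = grad_eqI[OF radial_has_derivative]

text \<open>The inner products of \<open>x\<close> and the gradient of \<phi> are themselves radial,
  so the expanded square is radial again.\<close>

lemma norm_grad_radial:
  assumes "x \<noteq> 0"
  shows "(norm (grad (radial D G) x))\<^sup>2 = radial (2 * D - 2) (ode_weight D m G) x"
proof -
  have e: "D - 2 + (D - 2) + 2 = 2 * D - 2" "D - 2 + (D - m) + m = 2 * D - 2"
    "D - m + (D - m) + (2 * real m - 2) = 2 * D - 2" by simp_all
  let ?k = "radial (D - 2) (radial_coeff D G) x" and ?l = "radial (D - m) (pderiv G) x"
  have "(norm (grad (radial D G) x))\<^sup>2
      = (?k * ?k) * (x \<bullet> x) + (2 * m) * ((?k * ?l) * \<phi> x) + (real m)^2 * ((?l * ?l) * (x \<bullet> x) ^ (m - 1))"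
    unfolding radial_grad[OF assms] power2_norm_eq_inner
    by (simp add: inner_add_left inner_add_right inner_commute[of x "grad \<phi> x"] euler grad_inner_self algebra_simps)
  also have "\<dots> = radial (2 * D - 2) (radial_coeff D G * radial_coeff D G * 1
      + smult (2 * m) (radial_coeff D G * pderiv G * [:0,1:]) + smult ((real m)^2) (pderiv G * pderiv G * 1)) x"
    unfolding radial_base(2)[OF assms] unfolding radial_base(1,3)[OF assms] radial_mult e
      radial_smult[of "2 * m"] radial_smult[of "(real m)^2"] radial_add ..
  also have "radial_coeff D G * radial_coeff D G * 1
      + smult (2 * m) (radial_coeff D G * pderiv G * [:0,1:]) + smult ((real m)^2) (pderiv G * pderiv G * 1)
      = ode_weight D m G"
    by (simp add: radial_coeff_def ode_weight_def poly_eq_poly_eq_iff[symmetric] fun_eq_iff algebra_simps power2_eq_square)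
  finally show ?thesis .
qed

text \<open>As \<open>u\<close> is radial on the open complement of 0, its derivatives at
  \<open>x\<close> are those of the radial formula; on the unit sphere all powers of the norm become
  1.\<close>

lemma p_laplacian_radial:
  fixes a b :: real
  assumes u: "\<And>x. x \<noteq> 0 \<Longrightarrow> u x = radial D G x" and x: "x \<bullet> x = 1"
    and lap: "laplacian \<phi> x = b * (real m)\<^sup>2" and n: "real CARD('n) = a * m + 2"
  shows "p_laplacian p u x = poly (ode_p_laplacian ((p - 2) / 2) D m (real CARD('n)) a b G) (\<phi> x)"
proof -
  have x0: "x \<noteq> 0" using x by auto
  have op: "open (- {0::real^'n})" by (rule open_Compl[OF closed_singleton])
  have du: "(u has_derivative
    (\<lambda>h. (radial (D - 2) (radial_coeff D G) y *\<^sub>R y + radial (D - m) (pderiv G) y *\<^sub>R grad \<phi> y) \<bullet> h)) (at y)"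
    if "y \<noteq> 0" for y
    by (rule has_derivative_transform_within_open[OF radial_has_derivative[OF that] op]) (use that u in auto)
  note gu = grad_eqI[OF du]
  have nu: "(norm (grad u y))\<^sup>2 = radial (2 * D - 2) (ode_weight D m G) y" if "y \<noteq> 0" for y
    using norm_grad_radial[OF that, of D G] by (simp add: gu[OF that] radial_grad[OF that])
  have "grad (\<lambda>y. (norm (grad u y))\<^sup>2) x =
      radial (2 * D - 2 - 2) (radial_coeff (2 * D - 2) (ode_weight D m G)) x *\<^sub>R x
      + radial (2 * D - 2 - m) (pderiv (ode_weight D m G)) x *\<^sub>R grad \<phi> x"
    by (intro grad_eqI has_derivative_transform_within_open[OF radial_has_derivative[OF x0] op]) (use x0 nu in auto)
  then have gn: "grad (\<lambda>y. (norm (grad u y))\<^sup>2) x =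
      poly (radial_coeff (2 * D - 2) (ode_weight D m G)) (\<phi> x) *\<^sub>R x
      + poly (pderiv (ode_weight D m G)) (\<phi> x) *\<^sub>R grad \<phi> x"
    using x by simp
  let ?t = "\<phi> x"
  let ?K = "radial_coeff D G"
  have gg: "grad \<phi> x \<bullet> grad \<phi> x = (real m)^2" "grad \<phi> x \<bullet> x = m * ?t" "x \<bullet> grad \<phi> x = m * ?t"
    by (simp_all add: grad_inner_self x euler inner_commute[of x "grad \<phi> x"])
  have gr: "grad (radial C F) x = poly (radial_coeff C F) ?t *\<^sub>R x + poly (pderiv F) ?t *\<^sub>R grad \<phi> x" for C F
    using radial_grad[OF x0, of C F] x by simp
  have pp: "partial (partial u i) i x = poly ?K ?t + (grad (radial (D - 2) ?K) x $ i) * x $ i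
      + poly (pderiv G) ?t * partial (partial \<phi> i) i x + (grad (radial (D - m) (pderiv G)) x $ i) * grad \<phi> x $ i" for i
  proof -
    let ?F = "\<lambda>y. radial (D - 2) ?K y * y $ i + radial (D - m) (pderiv G) y * partial \<phi> i y"
    have "(?F has_derivative (\<lambda>h. (radial (D - 2) ?K x * h $ i + (grad (radial (D - 2) ?K) x \<bullet> h) * x $ i)
        + (radial (D - m) (pderiv G) x * (grad (partial \<phi> i) x \<bullet> h) + (grad (radial (D - m) (pderiv G)) x \<bullet> h) * partial \<phi> i x))) (at x)"
      unfolding radial_grad[OF x0]
      by (intro has_derivative_add has_derivative_mult radial_has_derivative x0 polyfun_has_grad polyfun_partial polyfun
        bounded_linear_imp_has_derivative bounded_linear_vec_nth)
    then have "(partial u i has_derivative (\<lambda>h. (radial (D - 2) ?K x * h $ i + (grad (radial (D - 2) ?K) x \<bullet> h) * x $ i)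
        + (radial (D - m) (pderiv G) x * (grad (partial \<phi> i) x \<bullet> h) + (grad (radial (D - m) (pderiv G)) x \<bullet> h) * partial \<phi> i x))) (at x)"
      by (rule has_derivative_transform_within_open[OF _ op]) (use x0 gu in \<open>auto simp: grad_nth[symmetric] simp del: grad_nth\<close>)
    from partial_eqI[OF this, of i] show ?thesis using x by (simp add: inner_axis)
  qed
  have "laplacian u x = CARD('n) * poly ?K ?t + grad (radial (D - 2) ?K) x \<bullet> x
      + poly (pderiv G) ?t * laplacian \<phi> x + grad (radial (D - m) (pderiv G)) x \<bullet> grad \<phi> x"
    unfolding laplacian_def pp by (simp add: sum.distrib sum_distrib_left inner_vec_def)
  also have "\<dots> = poly (ode_laplacian D m (real CARD('n)) a b G) ?t"
    unfolding gr inner_add_left inner_scaleR_left gg x lap n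
    by (simp add: radial_coeff_def ode_laplacian_def pderiv_diff pderiv_smult pderiv_mult pderiv_pCons algebra_simps power2_eq_square)
  finally have L: "laplacian u x = poly (ode_laplacian D m (real CARD('n)) a b G) ?t" .
  have I: "grad u x \<bullet> grad (\<lambda>y. (norm (grad u y))\<^sup>2) x =
      D * (2 * D - 2) * poly G ?t * poly (ode_weight D m G) ?t
      + (real m)^2 * (1 - ?t^2) * poly (pderiv G) ?t * poly (pderiv (ode_weight D m G)) ?t"
    unfolding gn gu[OF x0] using x
    by (simp add: inner_add_left inner_add_right gg radial_coeff_def algebra_simps power2_eq_square)
  show ?thesis
    unfolding p_laplacian_def L I nu[OF x0] radial_unit[OF x] ode_p_laplacian_def
    by (simp add: algebra_simps)
qed

end

section \<open>Contradiction from a polynomial identity on the interval from -1 to 1\<close>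

theorem theorem5p1:
  fixes p :: real and m m1 m2 :: nat and \<phi> :: "real^'n::finite \<Rightarrow> real"
  assumes "p > 1" and "p \<noteq> 2"
    and "CARD('n) \<ge> 2"
    and "m > 0" and "m1 > 0" and "m2 > 0" and "m1 \<le> m2"
    and "real CARD('n) = (real m1 + real m2) * real m / 2 + 2"
    and "hom_poly m \<phi>"
    and "\<forall>x. (norm (grad \<phi> x))\<^sup>2 = (real m)\<^sup>2 * norm x ^ (2 * m - 2)"
    and "\<forall>x. laplacian \<phi> x = (real m2 - real m1) * (real m)\<^sup>2 / 2 * norm x ^ (m - 2)"
  shows "\<not> (\<exists>(u :: real^'n \<Rightarrow> real) d U (f :: real \<times> real \<Rightarrow> real).
            d \<ge> 2 \<and> hom_poly d u \<and> (\<exists>x. u x \<noteq> 0) \<and>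
            (\<forall>x. p_laplacian p u x = 0) \<and>
            C2_on U f \<and> (\<forall>x. (norm x ^ m, \<phi> x) \<in> U) \<and>
            (\<forall>x. u x = f (norm x ^ m, \<phi> x)))"
proof
  assume "\<exists>(u :: real^'n \<Rightarrow> real) d U (f :: real \<times> real \<Rightarrow> real).
            d \<ge> 2 \<and> hom_poly d u \<and> (\<exists>x. u x \<noteq> 0) \<and>
            (\<forall>x. p_laplacian p u x = 0) \<and>
            C2_on U f \<and> (\<forall>x. (norm x ^ m, \<phi> x) \<in> U) \<and>
            (\<forall>x. u x = f (norm x ^ m, \<phi> x))"
  then obtain u :: "real^'n \<Rightarrow> real" and d f where d: "d \<ge> 2" and hu: "hom_poly d u"
    and nz: "\<exists>x. u x \<noteq> 0" and pl: "\<And>x. p_laplacian p u x = 0" and uf: "\<And>x. u x = f (norm x ^ m, \<phi> x)"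
    by blast
  interpret eikonal_poly m \<phi>
    using assms by unfold_locales auto
  \<comment> \<open>So \<open>a - b = m1\<close> and \<open>a + b = m2\<close>, both
    positive.\<close>
  define a b where "a = (real m1 + real m2) / 2" and "b = (real m2 - real m1) / 2"
  have ab: "\<bar>b\<bar> < a" using assms by (simp add: a_def b_def)
  have n: "real CARD('n) = a * m + 2" using assms by (simp add: a_def)
  have unit: "norm x = 1" if "x \<bullet> x = 1" for x :: "real^'n" using that by (simp add: norm_eq_sqrt_inner)
  have lap: "laplacian \<phi> x = b * (real m)\<^sup>2" if "x \<bullet> x = 1" for x
    using assms unit[OF that] by (simp add: b_def)
  \<comment> \<open>Here \<open>a * m^2 = m * (n - 2)\<close>, with \<open>n\<close> the
    dimension.\<close>
  have "\<bar>laplacian \<phi> x\<bar> < m * (real m + CARD('n) - 2)" if "x \<bullet> x = 1" for x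
  proof -
    have "\<bar>laplacian \<phi> x\<bar> = \<bar>b\<bar> * (real m)\<^sup>2" by (simp add: lap[OF that] abs_mult)
    also have "\<dots> < a * (real m)\<^sup>2" using ab m by simp
    also have "\<dots> \<le> m * (real m + CARD('n) - 2)" by (simp add: n algebra_simps power2_eq_square)
    finally show ?thesis .
  qed
  then obtain x1 where "x1 \<bullet> x1 = 1" "\<bar>\<phi> x1\<bar> < 1" using exists_noncritical by blast
  then obtain e w where ew: "e \<bullet> e = 1" "w \<bullet> w = 1" "e \<bullet> w = 0"
    and circle: "\<And>\<theta>. \<phi> (cos \<theta> *\<^sub>R e + sin \<theta> *\<^sub>R w) = cos (real m * \<theta>)"
    by (rule great_circle) blast
  define X where "X \<theta> = cos \<theta> *\<^sub>R e + sin \<theta> *\<^sub>R w" for \<theta>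
  have X: "X \<theta> \<bullet> X \<theta> = 1" for \<theta>
    by (simp add: X_def inner_add_left inner_add_right ew inner_commute[of w e] flip: power2_eq_square)
  have uX: "u (X \<theta>) = f (1, cos (real m * \<theta>))" for \<theta>
    using uf[of "X \<theta>"] unit[OF X] circle by (simp add: X_def)
  then obtain g where g: "\<And>\<theta>. u (X \<theta>) = poly g (cos (real m * \<theta>))"
    using dihedral_symmetric_poly[OF hom_poly_polyfun[OF hu] m, of e w "\<lambda>t. f (1, t)"]
    unfolding X_def by blast
  \<comment> \<open>The value of \<phi> at \<open>y\<close> lies between -1 and 1, hence is attained
    on the circle; as \<open>u\<close> depends on \<phi> alone on the sphere, \<open>g\<close>
    represents it everywhere there.\<close>
  have ug: "u y = poly g (\<phi> y)" if y: "y \<bullet> y = 1" for y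
  proof -
    define \<theta> where "\<theta> = arccos (\<phi> y) / m"
    have t: "cos (real m * \<theta>) = \<phi> y"
      using abs_le_1_on_sphere[OF y] m by (simp add: \<theta>_def cos_arccos_abs)
    show ?thesis using uf[of y] uX[of \<theta>] g[of \<theta>] unit[OF y] unfolding t by simp
  qed
  have ur: "u x = radial d g x" if "x \<noteq> 0" for x
  proof -
    let ?y = "(1 / norm x) *\<^sub>R x"
    have y: "?y \<bullet> ?y = 1" using that by (simp add: power2_norm_eq_inner[symmetric] power2_eq_square)
    have pw: "(x \<bullet> x) powr (real k / 2) = norm x ^ k" for k
    proof -
      have "x \<bullet> x = norm x powr 2" using that by (simp add: power2_norm_eq_inner)
      then have "(x \<bullet> x) powr (real k / 2) = norm x powr real k"
        by (simp only: powr_powr) simp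
      then show ?thesis using that by (simp add: powr_realpow)
    qed
    have "u x = norm x ^ d * u ?y"
      using that hom_poly_scaleR[OF hu, of "norm x" ?y] by simp
    also have "\<dots> = norm x ^ d * poly g (\<phi> x / norm x ^ m)"
      unfolding ug[OF y] hom_poly_scaleR[OF hom] by (simp add: power_one_over)
    finally show ?thesis
      unfolding radial_def minus_divide_left[symmetric] powr_minus pw by (simp add: divide_inverse)
  qed
  have "g \<noteq> 0"
  proof
    assume "g = 0"
    then have "u x = 0" if "x \<noteq> 0" for x using ur[OF that] by (simp add: radial_def)
    moreover have "u 0 = 0" using hom_poly_scaleR[OF hu, of 0 0] d by (simp add: power_0_left)
    ultimately show False using nz by metis
  qed
  moreover have "2 * ((p - 2) / 2) + 1 > 0" "(p - 2) / 2 \<noteq> 0" using assms(1,2) by (auto simp: field_simps)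
  ultimately have ne: "ode_p_laplacian ((p - 2) / 2) d m (real CARD('n)) a b g \<noteq> 0"
    using ode_p_laplacian_nonzero d m ab n by blast
  have "poly (ode_p_laplacian ((p - 2) / 2) d m (real CARD('n)) a b g) (cos (real m * \<theta>)) = 0" for \<theta>
    using p_laplacian_radial[OF ur X lap[OF X] n, of p \<theta>] pl circle by (simp add: X_def)
  \<comment> \<open>Every such \<open>t\<close> is \<open>cos (m * \<theta>)\<close> for
    \<open>\<theta> = arccos t / m\<close>.\<close>
  then have "poly (ode_p_laplacian ((p - 2) / 2) d m (real CARD('n)) a b g) t = 0" if "t \<in> {-1..1}" for t
    using that m by (metis atLeastAtMost_iff cos_arccos nonzero_mult_div_cancel_left of_nat_0_less_iff less_irrefl times_divide_eq_right)
  then have "{-1..1} \<subseteq> {t. poly (ode_p_laplacian ((p - 2) / 2) d m (real CARD('n)) a b g) t = 0}" by blast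
  then have "finite {-1..1::real}" using poly_roots_finite[OF ne] finite_subset by blast
  then show False by (simp add: infinite_Icc)
qed

end
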